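(* Assume that $\mathrm{zer}(G)\neq\emptyset$ and that $G=\frac1n\sum_{i=1}^nG_i$ satisfies, for some $L\in(0,+\infty)$ and all $x,y\in\mathbb{R}^p$, $$\frac1n\sum_{i=1}^n\langle G_ix-G_iy,x-y\rangle\ \ge\ \frac1L\Big[\frac1n\sum_{i=1}^n\|G_ix-G_iy\|^2\Big].$$ Let $\{x^k\}$ be generated by the method (VFKM) using a variance-reduced unbiased estimator $\widetilde S^k$ of $S^k$ with constants $\rho\in(0,1)$, $\Theta>0$, $\hat\Theta\ge0$ and sequence $\{\Delta_k\}$ such that $\Delta_0=0$ almost surely. Let $r>2$ and $\beta\in(0,\bar\beta)$ be given, and let $$\theta_k:=\frac{k}{k+r+2},\qquad \gamma_k:=\frac{k}{k+r},\qquad \eta_k:=\frac{2\beta(k+r)}{k+r+2}.$$ Let $x^\star\in\mathrm{zer}(G)$. Then, with $\bar\beta$ and $C_0,C_1,C_2,C_3$ as defined in the context: (a) $$\sum_{k=0}^\infty(2k+r+3)\,\mathbb{E}\big[\|x^{k+1}-x^k\|^2\big]\le C_0\|x^0-x^\star\|^2,$$ $$\sum_{k=0}^\infty(2k+r+3)\,\mathbb{E}\big[\|Gx^k\|^2\big]\le\frac{(r+2)^2}{2\beta^2r^2}\Big(C_0+\frac{2C_1}{r-2}\Big)\|x^0-x^\star\|^2.$$ (b) For all $k\ge0$, $$\mathbb{E}\big[\|x^{k+1}-x^k\|^2\big]\le\frac{C_2\|x^0-x^\star\|^2}{(k+r+2)^2},\qquad \mathbb{E}\big[\|Gx^k\|^2\big]\le\frac{C_3\|x^0-x^\star\|^2}{\beta^2(k+r-1)(k+r+2)}.$$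 (c) $$\lim_{k\to\infty}k^2\,\mathbb{E}\big[\|x^{k+1}-x^k\|^2\big]=0\quad\text{and}\quad\lim_{k\to\infty}k^2\,\mathbb{E}\big[\|Gx^k\|^2\big]=0.$$ Moreover, for a given $\epsilon>0$, (VFKM) requires $\mathcal{O}(1/\epsilon)$ iterations to achieve $\mathbb{E}[\|Gx^k\|^2]\le\epsilon^2$.
   Context: Setting. $n,p\ge1$ are integers, $[n]=\{1,\dots,n\}$, $G_i:\mathbb{R}^p\to\mathbb{R}^p$ ($i\in[n]$) are single-valued mappings, $Gx:=\frac1n\sum_{i=1}^nG_ix$, and $\mathrm{zer}(G):=\{x^\star\in\mathbb{R}^p: Gx^\star=0\}$. $\langle\cdot,\cdot\rangle$ and $\|\cdot\|$ are the standard inner product and norm. Method (VFKM). Given (deterministic) $x^0\in\mathbb{R}^p$, set $x^{-1}:=x^0$. At each iteration $k\ge0$ let $S^k:=Gx^k-\gamma_kGx^{k-1}$, construct a random estimator $\widetilde S^k$ of $S^k$ (with $\widetilde S^0:=S^0$), and update $x^{k+1}:=x^k+\theta_k(x^k-x^{k-1})-\eta_k\widetilde S^k$. Variance-reduced unbiased estimator. $\mathcal{F}_k$ is the $\sigma$-algebra containing all information generated by the algorithm up to iteration $k$ before constructing $\widetilde S^k$ (so $x^0,\dots,x^k$ and $\Delta_0,\dots,\Delta_{k-1}$ are $\mathcal{F}_k$-measurable), $\mathbb{E}_k[\cdot]:=\mathbb{E}[\cdot\mid\mathcal{F}_k]$, and $\mathbb{E}$ is the total expectation. $\widetilde S^k$,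 constructed using fresh randomness conditionally on $\mathcal{F}_k$, is a variance-reduced unbiased estimator of $S^k$ if there exist $\rho\in(0,1)$, $\Theta>0$, $\hat\Theta\ge0$ and nonnegative random variables $\{\Delta_k\}$ such that for all $k\ge1$, almost surely: $\mathbb{E}_k[\widetilde S^k-S^k]=0$; $\mathbb{E}_k[\|\widetilde S^k-S^k\|^2]\le\mathbb{E}_k[\Delta_k]$; and $$\tfrac{1}{(1-\gamma_k)^2}\mathbb{E}_k[\Delta_k]\le\tfrac{1-\rho}{(1-\gamma_{k-1})^2}\Delta_{k-1}+\tfrac{\Theta}{(1-\gamma_k)^2}U_k+\tfrac{\hat\Theta}{(1-\gamma_{k-1})^2}U_{k-1},$$ where $U_k:=\frac1n\sum_{i=1}^n\|G_ix^k-G_ix^{k-1}\|^2$ (so $U_0=0$). Constants: $$\bar\beta:=\min\Big\{\frac{\rho}{[\rho+(r+1)(\Theta+\hat\Theta)]L},\frac{1}{(r+1)L}\Big\},\quad \Lambda:=\frac{4\beta\big(\rho-[\rho+(r+1)(\Theta+\hat\Theta)]L\beta\big)}{L\rho(r+1)},\quad \psi:=\frac{4\beta^2(\Theta+\hat\Theta)}{\rho\Lambda},$$ $$C_0:=r(1+3r+8rL^2\beta^2),\qquad C_1:=\frac{4r^2(r-1)L^2\beta^2}{r+2}+\Big(\frac2r+\psi\Big)C_0,$$ $$C_2:=4r^2L^2\beta^2+\Big[\psi+\frac{2(r+2)^2}{r}\Big]C_0+\frac{4(r+2)^2C_1}{r(r-2)},\qquad C_3:=\frac{(r+2)^2(C_1+C_2)}{2r^2}.$$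 In the iteration complexity statement the constant hidden in $\mathcal{O}$ does not depend on $\epsilon$. *)

theory Defs
  imports "HOL-Probability.Probability"
begin

section \<open>Finite sums of mappings on \<open>\<real>\<^sup>p\<close>\<close>

definition avg_map :: "nat \<Rightarrow> (nat \<Rightarrow> real^'p \<Rightarrow> real^'p) \<Rightarrow> real^'p \<Rightarrow> real^'p" where
  "avg_map n G x = (1 / real n) *\<^sub>R (\<Sum>i=1..n. G i x)"

definition zer :: "(real^'p \<Rightarrow> real^'p) \<Rightarrow> (real^'p) set" where
  "zer T = {x. T x = 0}"

definition avg_cocoercive :: "nat \<Rightarrow> (nat \<Rightarrow> real^'p \<Rightarrow> real^'p) \<Rightarrow> real \<Rightarrow> bool" where
  "avg_cocoercive n G L \<longleftrightarrow>
    (\<forall>x y. (1 / real n) * (\<Sum>i=1..n. (G i x - G i y) \<bullet> (x - y))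
        \<ge> (1 / L) * ((1 / real n) * (\<Sum>i=1..n. (norm (G i x - G i y))\<^sup>2)))"

section \<open>The stochastic method\<close>

text \<open>
  A process is a function of the iteration counter and of the sample point. The convention
  \<open>x\<^sup>-\<^sup>1 = x\<^sup>0\<close> is rendered by truncated subtraction on \<^typ>\<open>nat\<close>: \<open>x (k - 1)\<close> is \<open>x 0\<close> for \<open>k = 0\<close>.
\<close>

definition vfkm_S :: "nat \<Rightarrow> (nat \<Rightarrow> real^'p \<Rightarrow> real^'p) \<Rightarrow> (nat \<Rightarrow> real)
    \<Rightarrow> (nat \<Rightarrow> 'w \<Rightarrow> real^'p) \<Rightarrow> nat \<Rightarrow> 'w \<Rightarrow> real^'p" where
  "vfkm_S n G \<gamma> x k \<omega> = avg_map n G (x k \<omega>) - \<gamma> k *\<^sub>R avg_map n G (x (k - 1) \<omega>)"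

definition vfkm_U :: "nat \<Rightarrow> (nat \<Rightarrow> real^'p \<Rightarrow> real^'p)
    \<Rightarrow> (nat \<Rightarrow> 'w \<Rightarrow> real^'p) \<Rightarrow> nat \<Rightarrow> 'w \<Rightarrow> real" where
  "vfkm_U n G x k \<omega> = (1 / real n) * (\<Sum>i=1..n. (norm (G i (x k \<omega>) - G i (x (k - 1) \<omega>)))\<^sup>2)"

definition vfkm_iterates :: "'w measure \<Rightarrow> nat \<Rightarrow> (nat \<Rightarrow> real^'p \<Rightarrow> real^'p)
    \<Rightarrow> (nat \<Rightarrow> real) \<Rightarrow> (nat \<Rightarrow> real) \<Rightarrow> (nat \<Rightarrow> real)
    \<Rightarrow> real^'p \<Rightarrow> (nat \<Rightarrow> 'w \<Rightarrow> real^'p) \<Rightarrow> (nat \<Rightarrow> 'w \<Rightarrow> real^'p) \<Rightarrow> bool" where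
  "vfkm_iterates M n G \<theta> \<gamma> \<eta> x0 x St \<longleftrightarrow>
    (\<forall>\<omega>\<in>space M.
       x 0 \<omega> = x0 \<and>
       St 0 \<omega> = vfkm_S n G \<gamma> x 0 \<omega> \<and>
       (\<forall>k. x (Suc k) \<omega> = x k \<omega> + \<theta> k *\<^sub>R (x k \<omega> - x (k - 1) \<omega>) - \<eta> k *\<^sub>R St k \<omega>))"

text \<open>
  \<open>F k\<close> carries the information available before \<open>St k\<close> is constructed; since \<open>F\<close> is increasing,
  all of \<open>x 0, \<dots>, x k\<close> and \<open>\<Delta> 0, \<dots>, \<Delta> (k - 1)\<close> are \<open>F k\<close>-measurable.
\<close>

definition vfkm_filtration :: "'w measure \<Rightarrow> (nat \<Rightarrow> 'w measure)
    \<Rightarrow> (nat \<Rightarrow> 'w \<Rightarrow> real^'p) \<Rightarrow> (nat \<Rightarrow> 'w \<Rightarrow> real) \<Rightarrow> bool" where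
  "vfkm_filtration M F x \<Delta> \<longleftrightarrow>
    filtration (space M) F \<and>
    (\<forall>k. subalgebra M (F k)) \<and>
    (\<forall>k. x k \<in> borel_measurable (F k)) \<and>
    (\<forall>k. \<Delta> k \<in> borel_measurable (F (Suc k)))"

definition vec_cond_exp :: "'w measure \<Rightarrow> 'w measure \<Rightarrow> ('w \<Rightarrow> real^'p) \<Rightarrow> 'w \<Rightarrow> real^'p" where
  "vec_cond_exp M F f \<omega> = (\<chi> j. real_cond_exp M F (\<lambda>\<omega>'. f \<omega>' $ j) \<omega>)"

text \<open>
  Conditional expectations of nonnegative variables are taken in \<^typ>\<open>ennreal\<close>, so no integrability
  has to be presupposed. For \<open>\<gamma> k < 1\<close> the last condition makes the conditional expectation of
  \<open>\<Delta> k\<close> almost surely finite, hence also the conditional second moment of \<open>St k - S k\<close>; therefore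
  the conditional mean in the unbiasedness condition is a genuine one.
\<close>

definition vr_unbiased_estimator :: "'w measure \<Rightarrow> (nat \<Rightarrow> 'w measure) \<Rightarrow> nat
    \<Rightarrow> (nat \<Rightarrow> real^'p \<Rightarrow> real^'p) \<Rightarrow> (nat \<Rightarrow> real)
    \<Rightarrow> (nat \<Rightarrow> 'w \<Rightarrow> real^'p) \<Rightarrow> (nat \<Rightarrow> 'w \<Rightarrow> real^'p)
    \<Rightarrow> real \<Rightarrow> real \<Rightarrow> real \<Rightarrow> (nat \<Rightarrow> 'w \<Rightarrow> real) \<Rightarrow> bool" where
  "vr_unbiased_estimator M F n G \<gamma> x St \<rho> \<Theta> \<Theta>h \<Delta> \<longleftrightarrow>
    0 < \<rho> \<and> \<rho> < 1 \<and> 0 < \<Theta> \<and> 0 \<le> \<Theta>h \<and>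
    (\<forall>k. St k \<in> borel_measurable M) \<and>
    (\<forall>k. \<Delta> k \<in> borel_measurable M \<and> (AE \<omega> in M. 0 \<le> \<Delta> k \<omega>)) \<and>
    (\<forall>k\<ge>1.
      (AE \<omega> in M. vec_cond_exp M (F k) (\<lambda>\<omega>'. St k \<omega>' - vfkm_S n G \<gamma> x k \<omega>') \<omega> = 0) \<and>
      (AE \<omega> in M.
         nn_cond_exp M (F k) (\<lambda>\<omega>'. ennreal ((norm (St k \<omega>' - vfkm_S n G \<gamma> x k \<omega>'))\<^sup>2)) \<omega>
           \<le> nn_cond_exp M (F k) (\<lambda>\<omega>'. ennreal (\<Delta> k \<omega>')) \<omega>) \<and>
      (AE \<omega> in M.
         ennreal (1 / (1 - \<gamma> k)\<^sup>2) * nn_cond_exp M (F k) (\<lambda>\<omega>'. ennreal (\<Delta> k \<omega>')) \<omega>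
           \<le> ennreal ((1 - \<rho>) / (1 - \<gamma> (k - 1))\<^sup>2 * \<Delta> (k - 1) \<omega>
               + \<Theta> / (1 - \<gamma> k)\<^sup>2 * vfkm_U n G x k \<omega>
               + \<Theta>h / (1 - \<gamma> (k - 1))\<^sup>2 * vfkm_U n G x (k - 1) \<omega>)))"

section \<open>Constants\<close>

definition beta_bar :: "real \<Rightarrow> real \<Rightarrow> real \<Rightarrow> real \<Rightarrow> real \<Rightarrow> real" where
  "beta_bar r L \<rho> \<Theta> \<Theta>h =
    min (\<rho> / ((\<rho> + (r + 1) * (\<Theta> + \<Theta>h)) * L)) (1 / ((r + 1) * L))"

definition const_Lambda :: "real \<Rightarrow> real \<Rightarrow> real \<Rightarrow> real \<Rightarrow> real \<Rightarrow> real \<Rightarrow> real" where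
  "const_Lambda r L \<beta> \<rho> \<Theta> \<Theta>h =
    4 * \<beta> * (\<rho> - (\<rho> + (r + 1) * (\<Theta> + \<Theta>h)) * L * \<beta>) / (L * \<rho> * (r + 1))"

definition const_psi :: "real \<Rightarrow> real \<Rightarrow> real \<Rightarrow> real \<Rightarrow> real \<Rightarrow> real \<Rightarrow> real" where
  "const_psi r L \<beta> \<rho> \<Theta> \<Theta>h = 4 * \<beta>\<^sup>2 * (\<Theta> + \<Theta>h) / (\<rho> * const_Lambda r L \<beta> \<rho> \<Theta> \<Theta>h)"

definition const_C0 :: "real \<Rightarrow> real \<Rightarrow> real \<Rightarrow> real" where
  "const_C0 r L \<beta> = r * (1 + 3 * r + 8 * r * L\<^sup>2 * \<beta>\<^sup>2)"

definition const_C1 :: "real \<Rightarrow> real \<Rightarrow> real \<Rightarrow> real \<Rightarrow> real \<Rightarrow> real \<Rightarrow> real" where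
  "const_C1 r L \<beta> \<rho> \<Theta> \<Theta>h =
    4 * r\<^sup>2 * (r - 1) * L\<^sup>2 * \<beta>\<^sup>2 / (r + 2)
      + (2 / r + const_psi r L \<beta> \<rho> \<Theta> \<Theta>h) * const_C0 r L \<beta>"

definition const_C2 :: "real \<Rightarrow> real \<Rightarrow> real \<Rightarrow> real \<Rightarrow> real \<Rightarrow> real \<Rightarrow> real" where
  "const_C2 r L \<beta> \<rho> \<Theta> \<Theta>h =
    4 * r\<^sup>2 * L\<^sup>2 * \<beta>\<^sup>2
      + (const_psi r L \<beta> \<rho> \<Theta> \<Theta>h + 2 * (r + 2)\<^sup>2 / r) * const_C0 r L \<beta>
      + 4 * (r + 2)\<^sup>2 * const_C1 r L \<beta> \<rho> \<Theta> \<Theta>h / (r * (r - 2))"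

definition const_C3 :: "real \<Rightarrow> real \<Rightarrow> real \<Rightarrow> real \<Rightarrow> real \<Rightarrow> real \<Rightarrow> real" where
  "const_C3 r L \<beta> \<rho> \<Theta> \<Theta>h =
    (r + 2)\<^sup>2 * (const_C1 r L \<beta> \<rho> \<Theta> \<Theta>h + const_C2 r L \<beta> \<rho> \<Theta> \<Theta>h) / (2 * r\<^sup>2)"

end

theory Submission
  imports Defs
begin

text \<open>
  Write \<open>d\<^sub>k = x\<^sub>k - x\<^sub>k\<^sub>-\<^sub>1\<close>, \<open>X\<^sub>k = x\<^sub>k - x\<^sup>*\<close>, \<open>G\<^sub>k = G x\<^sub>k\<close> and let \<open>e\<^sub>k\<close> be the error of the estimator. The choice of
  parameters turns the method into the linear recursion
  \<open>(k+r+2) d\<^sub>k\<^sub>+\<^sub>1 = y\<^sub>k - 2\<beta>(k+r) e\<^sub>k\<close> with \<open>y\<^sub>k = k d\<^sub>k - 2\<beta>[(k+r) G\<^sub>k - k G\<^sub>k\<^sub>-\<^sub>1]\<close>, where \<open>y\<^sub>k\<close> is known at time \<open>k\<close>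
  and \<open>e\<^sub>k\<close> is conditionally centred. Hence for every \<open>Z\<close> known at time \<open>k\<close> the expectation of
  \<open>|Z + (k+r+2) d\<^sub>k\<^sub>+\<^sub>1|\<^sup>2\<close> is that of \<open>|Z + y\<^sub>k|\<^sup>2\<close> plus \<open>4\<beta>\<^sup>2(k+r)\<^sup>2 E|e\<^sub>k|\<^sup>2\<close>
  (\<open>expectation_shifted_increment\<close>), so everything reduces to three deterministic inequalities, one
  for each of the shifts \<open>Z = r X\<^sub>k\<close>, \<open>Z = 2\<beta>(k+r) G\<^sub>k\<close> and \<open>Z = 0\<close>.
  
  The shift \<open>r X\<^sub>k\<close> gives a Lyapunov function,
  \<open>|r X\<^sub>k\<^sub>-\<^sub>1 + (k+r+1) d\<^sub>k|\<^sup>2 + r|X\<^sub>k\<^sub>-\<^sub>1|\<^sup>2 + 4\<beta>rk(\<langle>G\<^sub>k\<^sub>-\<^sub>1, X\<^sub>k\<^sub>-\<^sub>1\<rangle> - \<beta>|G\<^sub>k\<^sub>-\<^sub>1|\<^sup>2)\<close>.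
  It obeys an exact identity (\<open>energy_step_identity\<close>); the decrease contains \<open>(2k+r+1)|d\<^sub>k|\<^sup>2\<close> and, by
  cocoercivity, a positive multiple of \<open>k(k+r) U\<^sub>k\<close>. Adding multiples of \<open>(k+r-1)\<^sup>2 E\<Delta>\<^sub>k\<^sub>-\<^sub>1\<close> and
  \<open>(k+r-1)\<^sup>2 EU\<^sub>k\<^sub>-\<^sub>1\<close> absorbs the noise, at the price of a part of the \<open>U\<^sub>k\<close> term; what is left is
  exactly \<open>\<Lambda>(k+r)\<^sup>2 U\<^sub>k\<close>, and \<open>\<Lambda> > 0\<close> is the meaning of the bound on \<open>\<beta>\<close>. The initial energy is at most
  \<open>r(r+1)|X\<^sub>0|\<^sup>2 \<le> C\<^sub>0|X\<^sub>0|\<^sup>2/2\<close>, which gives the first sum in (a) and shows that the accumulated noise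
  is at most \<open>\<psi>C\<^sub>0|X\<^sub>0|\<^sup>2\<close> (\<open>energy_sum\<close>, \<open>noise_sum\<close>).
  
  The shift \<open>2\<beta>(k+r) G\<^sub>k\<close> produces the residual \<open>v\<^sub>k\<^sub>+\<^sub>1 = d\<^sub>k\<^sub>+\<^sub>1 + \<eta>\<^sub>k G\<^sub>k\<close>, whose recursion contracts up to
  terms already known to be summable; as \<open>v\<^sub>1 = 0\<close>, this bounds both \<open>(k+r+2)\<^sup>2 E|v\<^sub>k\<^sub>+\<^sub>1|\<^sup>2\<close> and the sum of
  \<open>(2k+r+1) E|v\<^sub>k|\<^sup>2\<close> (\<open>residual_sum\<close>). Since \<open>\<eta>\<^sub>k G\<^sub>k = v\<^sub>k\<^sub>+\<^sub>1 - d\<^sub>k\<^sub>+\<^sub>1\<close>, the second sum in (a) follows. The shift \<open>0\<close>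
  then bounds \<open>(k+r+2)\<^sup>2 E|d\<^sub>k\<^sub>+\<^sub>1|\<^sup>2\<close> by quantities that have been summed (\<open>increment_le\<close>), and (b) and
  the complexity bound follow.
  
  For (c), \<open>(k+r+2)\<^sup>2 E|d\<^sub>k\<^sub>+\<^sub>1|\<^sup>2\<close> and \<open>(k+r+2)\<^sup>2 E|v\<^sub>k\<^sub>+\<^sub>1|\<^sup>2\<close> increase by at most a summable amount at each step,
  hence converge, and the limit must be \<open>0\<close> because the same quantities divided by \<open>k+r+2\<close> are summable
  (\<open>quasi_decreasing_tendsto_0\<close>).
  
  All expectations are finite by induction: square integrability of the iterates up to \<open>k\<close> makes
  \<open>U\<^sub>k\<close> integrable, the variance condition then makes \<open>\<Delta>\<^sub>k\<close> integrable, and so \<open>e\<^sub>k\<close> and \<open>x\<^sub>k\<^sub>+\<^sub>1\<close> are square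
  integrable (\<open>second_moments\<close>).
\<close>

section \<open>Averaged cocoercive mappings\<close>

definition mean_sq_dist :: "nat \<Rightarrow> (nat \<Rightarrow> real^'p \<Rightarrow> real^'p) \<Rightarrow> real^'p \<Rightarrow> real^'p \<Rightarrow> real" where
  "mean_sq_dist n G x y = (1 / real n) * (\<Sum>i=1..n. (norm (G i x - G i y))\<^sup>2)"

lemma mean_sq_dist_nonneg: "0 \<le> mean_sq_dist n G x y"
  by (simp add: mean_sq_dist_def sum_nonneg)

lemma vfkm_U_eq: "vfkm_U n G x k \<omega> = mean_sq_dist n G (x k \<omega>) (x (k - 1) \<omega>)"
  by (simp add: vfkm_U_def mean_sq_dist_def)

lemma avg_map_diff: "avg_map n G x - avg_map n G y = (1 / real n) *\<^sub>R (\<Sum>i=1..n. G i x - G i y)"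
  by (simp add: avg_map_def sum_subtractf scaleR_diff_right)

text \<open>
  Convexity of the squared norm. Through it, bounds on the average of the \<open>G\<^sub>i\<close> follow from bounds on the mean
  squared distance \<open>U\<close>, which is the quantity that cocoercivity and the estimator control.
\<close>

lemma norm_avg_map_diff_le:
  assumes "n \<ge> 1"
  shows "(norm (avg_map n G x - avg_map n G y))\<^sup>2 \<le> mean_sq_dist n G x y"
proof -
  let ?a = "\<lambda>i. norm (G i x - G i y)"
  have "norm (\<Sum>i=1..n. G i x - G i y) \<le> (\<Sum>i=1..n. ?a i)" by (rule norm_sum)
  then have "(norm (\<Sum>i=1..n. G i x - G i y))\<^sup>2 \<le> (\<Sum>i=1..n. 1 * ?a i)\<^sup>2"
    by (simp add: power_mono)
  also have "\<dots> \<le> (\<Sum>i=1..n. 1\<^sup>2) * (\<Sum>i=1..n. (?a i)\<^sup>2)" by (rule Cauchy_Schwarz_ineq_sum)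
  also have "\<dots> = real n * (\<Sum>i=1..n. (?a i)\<^sup>2)" by simp
  finally have "(1 / real n)\<^sup>2 * (norm (\<Sum>i=1..n. G i x - G i y))\<^sup>2
      \<le> (1 / real n)\<^sup>2 * (real n * (\<Sum>i=1..n. (?a i)\<^sup>2))"
    by (intro mult_left_mono) auto
  then show ?thesis using assms
    by (simp add: avg_map_diff mean_sq_dist_def power_mult_distrib power2_eq_square field_simps)
qed

lemma avg_cocoerciveD:
  assumes "avg_cocoercive n G L" "L > 0"
  shows "mean_sq_dist n G x y \<le> L * ((avg_map n G x - avg_map n G y) \<bullet> (x - y))"
proof -
  have "(1 / L) * mean_sq_dist n G x y \<le> (avg_map n G x - avg_map n G y) \<bullet> (x - y)"
    using assms(1) by (simp add: avg_cocoercive_def mean_sq_dist_def avg_map_diff inner_sum_left)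
  then show ?thesis using assms(2) by (simp add: field_simps)
qed

text \<open>
  Averaged cocoercivity implies Lipschitz continuity: with \<open>p = |Gx - Gy|\<close> and \<open>w = |x - y|\<close> it gives
  \<open>p\<^sup>2 \<le> U \<le> L p w\<close>, hence \<open>p \<le> L w\<close> and \<open>U \<le> L\<^sup>2w\<^sup>2\<close>.
\<close>

lemma mean_sq_dist_le:
  assumes "n \<ge> 1" "avg_cocoercive n G L" "L > 0"
  shows "mean_sq_dist n G x y \<le> L\<^sup>2 * (norm (x - y))\<^sup>2"
proof -
  let ?p = "norm (avg_map n G x - avg_map n G y)" and ?w = "norm (x - y)"
  have q: "mean_sq_dist n G x y \<le> L * (?p * ?w)"
    using avg_cocoerciveD[OF assms(2,3), of x y] assms(3)
      norm_cauchy_schwarz[of "avg_map n G x - avg_map n G y" "x - y"]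
    by (smt (verit) mult_left_mono)
  have "?p * ?p \<le> (L * ?w) * ?p"
    using q norm_avg_map_diff_le[OF assms(1), of G x y] by (simp add: power2_eq_square mult_ac)
  then have "?p \<le> L * ?w"
    using assms(3) by (cases "?p = 0") (auto dest: mult_right_le_imp_le)
  then have "L * (?p * ?w) \<le> L * (L * ?w * ?w)"
    using assms(3) by (intro mult_left_mono mult_right_mono) auto
  with q show ?thesis by (simp add: power2_eq_square mult_ac)
qed

lemma avg_map_lipschitz:
  assumes "n \<ge> 1" "avg_cocoercive n G L" "L > 0"
  shows "norm (avg_map n G x - avg_map n G y) \<le> L * norm (x - y)"
proof (rule power2_le_imp_le)
  show "(norm (avg_map n G x - avg_map n G y))\<^sup>2 \<le> (L * norm (x - y))\<^sup>2"
    using order_trans[OF norm_avg_map_diff_le[OF assms(1)] mean_sq_dist_le[OF assms]]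
    by (simp only: power_mult_distrib)
qed (use assms(3) in simp)

text \<open>
  Each single \<open>G\<^sub>i\<close> contributes at most \<open>n\<close> times the mean, so it is Lipschitz too. This
  supplies the measurability of \<open>U\<^sub>k\<close>.
\<close>

lemma avg_cocoercive_continuous:
  assumes "n \<ge> 1" "avg_cocoercive n G L" "L > 0" "i \<in> {1..n}"
  shows "continuous_on UNIV (G i)"
proof (rule lipschitz_on_continuous_on)
  show "(sqrt (real n) * L)-lipschitz_on UNIV (G i)"
  proof (rule lipschitz_onI)
    fix x y
    have "(norm (G i x - G i y))\<^sup>2 \<le> (\<Sum>i=1..n. (norm (G i x - G i y))\<^sup>2)"
      using assms(4) by (intro member_le_sum) auto
    also have "\<dots> = real n * mean_sq_dist n G x y" using assms(1) by (simp add: mean_sq_dist_def)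
    also have "\<dots> \<le> real n * (L\<^sup>2 * (norm (x - y))\<^sup>2)"
      by (intro mult_left_mono mean_sq_dist_le assms) auto
    also have "\<dots> = (sqrt (real n) * L * norm (x - y))\<^sup>2" by (simp add: power_mult_distrib)
    finally show "dist (G i x) (G i y) \<le> sqrt (real n) * L * dist x y"
      using assms(3) by (auto simp: dist_norm intro: power2_le_imp_le)
  qed (use assms(3) in auto)
qed

lemma avg_map_continuous:
  assumes "n \<ge> 1" "avg_cocoercive n G L" "L > 0"
  shows "continuous_on UNIV (avg_map n G)"
  unfolding avg_map_def
  by (intro continuous_intros avg_cocoercive_continuous[OF assms])

section \<open>Deterministic one-step estimates\<close>

lemma norm_sq_scaleR: "(norm (c *\<^sub>R (v::'a::real_inner)))\<^sup>2 = c\<^sup>2 * (norm v)\<^sup>2"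
  by (simp add: power_mult_distrib)

text \<open>
  The noise-free energy balance, with \<open>X = x\<^sub>k - x\<^sup>*\<close>, \<open>d = d\<^sub>k\<close>, \<open>G = G\<^sub>k\<close> and \<open>H = G\<^sub>k\<^sub>-\<^sub>1\<close>. The weight \<open>r\<close> of
  \<open>|X|\<^sup>2\<close> is the one that cancels the cross term \<open>2r\<langle>d, X\<rangle>\<close>. The remaining terms
  telescope because, with \<open>s = (k+r)G - kH\<close>,
  \<open>|s|\<^sup>2 = r(k+r)|G|\<^sup>2 - rk|H|\<^sup>2 + k(k+r)|G-H|\<^sup>2\<close>.
\<close>

lemma energy_step_identity:
  fixes X d G H :: "'a::real_inner" and k r \<beta> :: real
  shows "(norm (r *\<^sub>R X + (k *\<^sub>R d - (2 * \<beta>) *\<^sub>R ((k + r) *\<^sub>R G - k *\<^sub>R H))))\<^sup>2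
      + r * (norm X)\<^sup>2 + 4 * \<beta> * r * (k + 1) * (G \<bullet> X - \<beta> * (norm G)\<^sup>2)
    = (norm (r *\<^sub>R (X - d) + (k + r + 1) *\<^sub>R d))\<^sup>2
      + r * (norm (X - d))\<^sup>2 + 4 * \<beta> * r * k * (H \<bullet> (X - d) - \<beta> * (norm H)\<^sup>2)
      - (2 * k + r + 1) * (norm d)\<^sup>2
      - 4 * \<beta> * k * (k + r) * ((G - H) \<bullet> d - \<beta> * (norm (G - H))\<^sup>2)
      - 4 * \<beta> * r * (r - 1) * (G \<bullet> X - \<beta> * (norm G)\<^sup>2)"
proof -
  note c = inner_commute[of X d] inner_commute[of G X] inner_commute[of H X] inner_commute[of G d]
    inner_commute[of H d] inner_commute[of H G]
  show ?thesis
    unfolding power2_norm_eq_inner inner_add_left inner_add_right inner_diff_left inner_diff_right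
      inner_scaleR_left inner_scaleR_right c
    by algebra
qed

text \<open>
  With \<open>s = k+r-1\<close> and \<open>t = k+r+1\<close> one has \<open>d + 2\<beta>H = (t v - 2d)/s\<close>. Expanding the square and splitting the
  cross term by Young's inequality with weight \<open>r/2\<close> leaves the common factor \<open>t+r\<close>, and
  \<open>k\<^sup>2(t+r) \<le> (k+3)s\<^sup>2\<close> where \<open>k+3 = t-(r-2)\<close>. The weight \<open>r/2\<close> makes the coefficient of \<open>|d|\<^sup>2\<close> carry a
  factor \<open>4/r\<close>, which is what the constant \<open>C\<^sub>1\<close> leaves room for.
\<close>

lemma residual_step_bound:
  fixes d H :: "'a::real_inner" and k r \<beta> :: real
  assumes k: "k \<ge> 1" and r: "r > 2"
  defines "v \<equiv> d + (2 * \<beta> * (k + r - 1) / (k + r + 1)) *\<^sub>R H"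
  shows "(norm (k *\<^sub>R (d + (2 * \<beta>) *\<^sub>R H)))\<^sup>2
    \<le> ((k + r + 1)\<^sup>2 - (r - 2) * (k + r + 1)) * (norm v)\<^sup>2 + (4 / r) * (k + 3) * (norm d)\<^sup>2"
proof -
  define s t where "s = k + r - 1" and "t = k + r + 1"
  have pos: "s > 0" "t > 0" using k r by (auto simp: s_def t_def)
  have eq: "d + (2 * \<beta>) *\<^sub>R H = (1 / s) *\<^sub>R (t *\<^sub>R v - 2 *\<^sub>R d)"
  proof -
    have "t *\<^sub>R v - 2 *\<^sub>R d = s *\<^sub>R (d + (2 * \<beta>) *\<^sub>R H)"
    proof -
      have "t *\<^sub>R v = t *\<^sub>R d + (2 * \<beta> * s) *\<^sub>R H"
        using pos by (simp add: v_def t_def s_def scaleR_add_right)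
      moreover have "t *\<^sub>R d - 2 *\<^sub>R d = s *\<^sub>R d"
        by (simp add: s_def t_def flip: scaleR_diff_left)
      ultimately show ?thesis by (simp add: scaleR_add_right mult_ac add_diff_eq[symmetric] diff_add_eq[symmetric])
    qed
    then show ?thesis using pos by simp
  qed
  \<comment> \<open>Young's inequality with weight \<open>r/2\<close>\<close>
  have "0 \<le> (norm ((r / 2) *\<^sub>R v + d))\<^sup>2" by simp
  also have "\<dots> = (r / 2)\<^sup>2 * (norm v)\<^sup>2 + r * (v \<bullet> d) + (norm d)\<^sup>2"
    unfolding power2_norm_eq_inner
    by (simp add: inner_add_left inner_add_right inner_commute power2_eq_square algebra_simps)
  finally have cross: "- 4 * (v \<bullet> d) \<le> r * (norm v)\<^sup>2 + (4 / r) * (norm d)\<^sup>2"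
    using r by (simp add: field_simps power2_eq_square)
  have "(norm (t *\<^sub>R v - 2 *\<^sub>R d))\<^sup>2 = t\<^sup>2 * (norm v)\<^sup>2 + t * (- 4 * (v \<bullet> d)) + 4 * (norm d)\<^sup>2"
    unfolding power2_norm_eq_inner
    by (simp add: inner_diff_left inner_diff_right inner_commute power2_eq_square algebra_simps)
  also have "\<dots> \<le> t\<^sup>2 * (norm v)\<^sup>2 + t * (r * (norm v)\<^sup>2 + (4 / r) * (norm d)\<^sup>2) + 4 * (norm d)\<^sup>2"
    using mult_left_mono[OF cross, of t] pos by simp
  also have "\<dots> = (t + r) * (t * (norm v)\<^sup>2 + (4 / r) * (norm d)\<^sup>2)"
    using r by (simp add: field_simps power2_eq_square)
  finally have 1: "(norm (t *\<^sub>R v - 2 *\<^sub>R d))\<^sup>2 \<le> \<dots>" .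
  have "0 \<le> k * s * (r - 1) + 3 * s\<^sup>2 - k\<^sup>2 * (r + 2)"
  proof -
    have "k * k * (r - 1) \<le> k * s * (r - 1)" "k\<^sup>2 \<le> s\<^sup>2"
      using k r by (auto simp: s_def intro!: mult_right_mono mult_left_mono power_mono)
    moreover have "k\<^sup>2 * (r + 2) = k * k * (r - 1) + 3 * k\<^sup>2"
      by (simp add: power2_eq_square algebra_simps)
    ultimately show ?thesis by linarith
  qed
  also have "\<dots> = (k + 3) * s\<^sup>2 - k\<^sup>2 * (t + r)"
    by (simp add: s_def t_def power2_eq_square algebra_simps)
  finally have 2: "k\<^sup>2 / s\<^sup>2 * (t + r) \<le> k + 3"
    using pos by (simp add: field_simps)
  have "(norm (k *\<^sub>R (d + (2 * \<beta>) *\<^sub>R H)))\<^sup>2 = k\<^sup>2 / s\<^sup>2 * (norm (t *\<^sub>R v - 2 *\<^sub>R d))\<^sup>2"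
    unfolding eq by (simp add: power_mult_distrib power_divide)
  also have "\<dots> \<le> k\<^sup>2 / s\<^sup>2 * ((t + r) * (t * (norm v)\<^sup>2 + (4 / r) * (norm d)\<^sup>2))"
    by (intro mult_left_mono 1) auto
  also have "\<dots> = (k\<^sup>2 / s\<^sup>2 * (t + r)) * (t * (norm v)\<^sup>2 + (4 / r) * (norm d)\<^sup>2)"
    by (simp only: mult.assoc)
  also have "\<dots> \<le> (k + 3) * (t * (norm v)\<^sup>2 + (4 / r) * (norm d)\<^sup>2)"
    using pos r by (intro mult_right_mono 2) auto
  also have "\<dots> = (t\<^sup>2 - (r - 2) * t) * (norm v)\<^sup>2 + (4 / r) * (k + 3) * (norm d)\<^sup>2"
    by (simp add: t_def power2_eq_square algebra_simps add_divide_distrib)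
  finally show ?thesis by (simp add: t_def)
qed

text \<open>
  Written with \<open>(k+r)G - kH = k(G-H) + rG\<close>, the cross term with \<open>G - H\<close> dominates the quadratic
  one: \<open>\<beta>(k+r) \<le> k/L\<close> for \<open>k \<ge> 1\<close> when \<open>\<beta>(r+1)L \<le> 1\<close>. What is left of the
  cross terms, \<open>-4\<beta>kr\<langle>G, d\<rangle>\<close>, is split so that its \<open>|d|\<^sup>2\<close> part fits between \<open>k\<^sup>2\<close> and
  \<open>(k+r+1)\<^sup>2\<close>.
\<close>

lemma increment_step_bound:
  fixes d G H :: "'a::real_inner" and k r \<beta> L :: real
  assumes k: "k \<ge> 1" and r: "r > 2" and L: "L > 0" and \<beta>: "0 < \<beta>" "\<beta> * ((r + 1) * L) \<le> 1"
    and co: "(norm (G - H))\<^sup>2 \<le> L * ((G - H) \<bullet> d)"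
  shows "(norm (k *\<^sub>R d - (2 * \<beta>) *\<^sub>R ((k + r) *\<^sub>R G - k *\<^sub>R H)))\<^sup>2
    \<le> (k + r + 1)\<^sup>2 * (norm d)\<^sup>2 + 2 * \<beta>\<^sup>2 * r * (3 * k + 2 * r) * (norm G)\<^sup>2"
proof -
  have expand: "(norm (k *\<^sub>R d - (2 * \<beta>) *\<^sub>R ((k + r) *\<^sub>R G - k *\<^sub>R H)))\<^sup>2
    = k\<^sup>2 * (norm d)\<^sup>2 - 4 * \<beta> * k * r * (G \<bullet> d)
      - 4 * \<beta> * k * (k * ((G - H) \<bullet> d) - \<beta> * (k + r) * (norm (G - H))\<^sup>2)
      + 4 * \<beta>\<^sup>2 * r * ((k + r) * (norm G)\<^sup>2 - k * (norm H)\<^sup>2)"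
  proof -
    note c = inner_commute[of G d] inner_commute[of H d] inner_commute[of H G]
    show ?thesis
      unfolding power2_norm_eq_inner inner_add_left inner_add_right inner_diff_left inner_diff_right
        inner_scaleR_left inner_scaleR_right c
      by algebra
  qed
  have "\<beta> * (k + r) * (norm (G - H))\<^sup>2 \<le> \<beta> * ((r + 1) * k) * (L * ((G - H) \<bullet> d))"
  proof (rule mult_mono[OF _ co])
    have "r * 1 \<le> r * k" using k r by (intro mult_left_mono) auto
    then show "\<beta> * (k + r) \<le> \<beta> * ((r + 1) * k)"
      using \<beta> by (intro mult_left_mono) (auto simp: algebra_simps)
  qed (use k r \<beta> in auto)
  also have "\<dots> = (\<beta> * ((r + 1) * L)) * (k * ((G - H) \<bullet> d))" by (simp add: algebra_simps)
  also have "\<dots> \<le> 1 * (k * ((G - H) \<bullet> d))"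
  proof (intro mult_right_mono \<beta>)
    have "0 \<le> L * ((G - H) \<bullet> d)" using co by (rule order_trans[rotated]) simp
    then show "0 \<le> k * ((G - H) \<bullet> d)" using L k by (simp add: zero_le_mult_iff)
  qed
  finally have 1: "0 \<le> 4 * \<beta> * k * (k * ((G - H) \<bullet> d) - \<beta> * (k + r) * (norm (G - H))\<^sup>2)"
    using k \<beta> by simp
  have "0 \<le> (norm (d + \<beta> *\<^sub>R G))\<^sup>2" by simp
  also have "\<dots> = (norm d)\<^sup>2 + 2 * \<beta> * (G \<bullet> d) + \<beta>\<^sup>2 * (norm G)\<^sup>2"
    unfolding power2_norm_eq_inner
    by (simp add: inner_add_left inner_add_right inner_commute power2_eq_square algebra_simps)
  finally have "0 \<le> 2 * k * r * ((norm d)\<^sup>2 + 2 * \<beta> * (G \<bullet> d) + \<beta>\<^sup>2 * (norm G)\<^sup>2)"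
    using k r by simp
  then have 2: "- 4 * \<beta> * k * r * (G \<bullet> d) \<le> 2 * k * r * (norm d)\<^sup>2 + 2 * \<beta>\<^sup>2 * k * r * (norm G)\<^sup>2"
    by (simp add: algebra_simps)
  have 3: "0 \<le> 4 * \<beta>\<^sup>2 * r * (k * (norm H)\<^sup>2)" using k r by simp
  have "(k\<^sup>2 + 2 * k * r) * (norm d)\<^sup>2 \<le> (k + r + 1)\<^sup>2 * (norm d)\<^sup>2"
    using k r by (intro mult_right_mono) (auto simp: power2_eq_square algebra_simps)
  with 1 2 3 show ?thesis unfolding expand by (simp add: algebra_simps)
qed

section \<open>Telescoping and decay of real sequences\<close>

lemma telescope_bound:
  fixes W b c :: "nat \<Rightarrow> real"
  assumes "\<And>k. k \<ge> 1 \<Longrightarrow> W (Suc k) + b k \<le> W k + c k"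
  shows "W (Suc K) + (\<Sum>k=1..K. b k) \<le> W 1 + (\<Sum>k=1..K. c k)"
proof (induction K)
  case (Suc K)
  then show ?case using assms[of "Suc K"] by simp
qed simp

text \<open>
  Subtracting the partial sums of \<open>c\<close> makes \<open>(k+s)\<^sup>2a\<^sub>k\<close> decreasing, so it converges. A positive limit
  would make \<open>(k+s)a\<^sub>k\<close> eventually larger than a multiple of \<open>1/(k+s)\<close>, against its summability.
\<close>

lemma quasi_decreasing_tendsto_0:
  fixes a c :: "nat \<Rightarrow> real"
  assumes a: "\<And>k. a k \<ge> 0" and c: "\<And>k. c k \<ge> 0" "summable c"
    and step: "\<And>k. (real (Suc k) + s)\<^sup>2 * a (Suc k) \<le> (real k + s)\<^sup>2 * a k + c k"
    and sum: "summable (\<lambda>k. (real k + s) * a k)" and s: "s > 0"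
  shows "(\<lambda>k. (real k + s)\<^sup>2 * a k) \<longlonglongrightarrow> 0"
proof -
  define q where "q k = (real k + s)\<^sup>2 * a k" for k
  define z where "z k = q k + (\<Sum>j. c j) - (\<Sum>j<k. c j)" for k
  have "decseq z"
    using step by (intro decseq_SucI) (simp add: z_def q_def algebra_simps)
  moreover have "0 \<le> z k" for k
    using sum_le_suminf[OF c(2), of "{..<k}"] c(1) a by (auto simp: z_def q_def add_increasing)
  ultimately obtain l where zl: "z \<longlonglongrightarrow> l" by (metis decseq_convergent)
  have "(\<lambda>k. z k - ((\<Sum>j. c j) - (\<Sum>j<k. c j))) \<longlonglongrightarrow> l - ((\<Sum>j. c j) - (\<Sum>j. c j))"
    by (intro tendsto_intros zl summable_LIMSEQ c(2))
  then have ql: "q \<longlonglongrightarrow> l" by (simp add: z_def)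
  have "l \<ge> 0" using ql a by (intro LIMSEQ_le_const[OF ql]) (auto simp: q_def)
  moreover have "\<not> l > 0"
  proof
    assume "l > 0"
    then have "eventually (\<lambda>k. q k > l / 2) sequentially" using ql by (intro order_tendstoD) auto
    then have "eventually (\<lambda>k. norm ((l / 2) * inverse (real k + s)) \<le> (real k + s) * a k) sequentially"
    proof eventually_elim
      case (elim k)
      have "l / 2 \<le> (real k + s) * ((real k + s) * a k)"
        using elim by (simp add: q_def power2_eq_square mult.assoc)
      then show ?case using s \<open>l > 0\<close> by (simp add: field_simps abs_mult)
    qed
    then have "summable (\<lambda>k. (l / 2) * inverse (real k + s))"
      using sum by (rule summable_comparison_test_ev)
    then have "summable (\<lambda>k. inverse (real k + s))"
      using \<open>l > 0\<close> by (subst (asm) summable_cmult_iff) auto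
    moreover have "norm (inverse (real (Suc k))) \<le> (1 + s) * inverse (real k + s)" for k
      using s by (simp add: field_simps)
    ultimately have "summable (\<lambda>k. inverse (real (Suc k)))"
      using summable_comparison_test'[OF summable_mult, of "\<lambda>k. inverse (real k + s)" 0
          "\<lambda>k. inverse (real (Suc k))" "1 + s"] by blast
    then have "summable (\<lambda>k. inverse (real k))" by (subst (asm) summable_Suc_iff)
    then show False using not_summable_harmonic[where 'a = real] by (simp add: inverse_eq_divide)
  qed
  ultimately show ?thesis using ql by (simp add: q_def[abs_def])
qed

lemma reciprocal_square_decay_complexity:
  fixes q :: "nat \<Rightarrow> real"
  assumes "0 \<le> A" "\<And>k. q k \<le> A / (real k + 1)\<^sup>2"
  shows "\<exists>C>0. \<forall>\<epsilon>>0. \<exists>K::nat. real K \<le> C / \<epsilon> \<and> (\<forall>k\<ge>K. q k \<le> \<epsilon>\<^sup>2)"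
proof (intro exI[of _ "sqrt A + 1"] conjI allI impI)
  show "0 < sqrt A + 1" using assms(1) by (simp add: add_nonneg_pos)
  fix \<epsilon> :: real assume e: "\<epsilon> > 0"
  let ?C = "sqrt A + 1"
  have C: "0 < ?C" "A \<le> ?C\<^sup>2" using assms(1) by (auto simp: add_nonneg_pos power2_sum)
  show "\<exists>K::nat. real K \<le> ?C / \<epsilon> \<and> (\<forall>k\<ge>K. q k \<le> \<epsilon>\<^sup>2)"
  proof (intro exI[of _ "nat \<lfloor>?C / \<epsilon>\<rfloor>"] conjI allI impI)
    show "real (nat \<lfloor>?C / \<epsilon>\<rfloor>) \<le> ?C / \<epsilon>" using C e by (intro of_nat_floor) simp
    fix k assume "nat \<lfloor>?C / \<epsilon>\<rfloor> \<le> k"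
    then have "?C / \<epsilon> \<le> real k + 1" by linarith
    then have "?C \<le> \<epsilon> * (real k + 1)" using e by (simp add: field_simps)
    then have "?C\<^sup>2 \<le> (\<epsilon> * (real k + 1))\<^sup>2" using C by (intro power_mono) auto
    then have "A \<le> \<epsilon>\<^sup>2 * (real k + 1)\<^sup>2" using C(2) by (simp add: power_mult_distrib)
    then have "A / (real k + 1)\<^sup>2 \<le> \<epsilon>\<^sup>2" by (simp add: pos_divide_le_eq)
    with assms(2)[of k] show "q k \<le> \<epsilon>\<^sup>2" by linarith
  qed
qed

section \<open>Square integrable vectors and conditional expectation\<close>

text \<open>
  Measurability is included so that sums and inner products of such functions are integrable without
  side conditions.
\<close>

definition square_integrable :: "'a measure \<Rightarrow> ('a \<Rightarrow> 'b::euclidean_space) \<Rightarrow> bool" where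
  "square_integrable M f \<longleftrightarrow> f \<in> borel_measurable M \<and> integrable M (\<lambda>\<omega>. (norm (f \<omega>))\<^sup>2)"

lemma square_integrable_scaleR:
  "square_integrable M f \<Longrightarrow> square_integrable M (\<lambda>\<omega>. c *\<^sub>R f \<omega>)"
  by (auto simp: square_integrable_def power_mult_distrib intro: borel_measurable_scaleR)

lemma square_integrable_add:
  assumes "square_integrable M f" "square_integrable M g"
  shows "square_integrable M (\<lambda>\<omega>. f \<omega> + g \<omega>)"
proof -
  have [measurable]: "f \<in> borel_measurable M" "g \<in> borel_measurable M"
    using assms by (auto simp: square_integrable_def)
  have "integrable M (\<lambda>\<omega>. (norm (f \<omega> + g \<omega>))\<^sup>2)"
  proof (rule Bochner_Integration.integrable_bound)
    show "integrable M (\<lambda>\<omega>. 2 * (norm (f \<omega>))\<^sup>2 + 2 * (norm (g \<omega>))\<^sup>2)"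
      using assms by (simp add: square_integrable_def)
    have "(norm (x + y))\<^sup>2 \<le> 2 * (norm x)\<^sup>2 + 2 * (norm y)\<^sup>2" for x y :: 'b
      using zero_le_power2[of "norm (x - y)"]
      by (simp add: power2_norm_eq_inner inner_add_left inner_add_right inner_diff_left
          inner_diff_right inner_commute)
    then show "AE \<omega> in M. norm ((norm (f \<omega> + g \<omega>))\<^sup>2)
        \<le> norm (2 * (norm (f \<omega>))\<^sup>2 + 2 * (norm (g \<omega>))\<^sup>2)"
      by (intro always_eventually) simp
  qed measurable
  then show ?thesis by (simp add: square_integrable_def)
qed

lemma square_integrable_diff:
  assumes "square_integrable M f" "square_integrable M g"
  shows "square_integrable M (\<lambda>\<omega>. f \<omega> - g \<omega>)"
  using square_integrable_add[OF assms(1) square_integrable_scaleR[OF assms(2), of "- 1"]] by simp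

lemma (in finite_measure) square_integrable_const: "square_integrable M (\<lambda>_. c)"
  by (simp add: square_integrable_def)

lemma square_integrable_bounded_by:
  assumes "square_integrable M f" "g \<in> borel_measurable M" "\<And>\<omega>. \<omega> \<in> space M \<Longrightarrow> norm (g \<omega>) \<le> c * norm (f \<omega>)"
  shows "square_integrable M g"
  unfolding square_integrable_def
proof
  show "integrable M (\<lambda>\<omega>. (norm (g \<omega>))\<^sup>2)"
  proof (rule Bochner_Integration.integrable_bound)
    show "integrable M (\<lambda>\<omega>. c\<^sup>2 * (norm (f \<omega>))\<^sup>2)"
      using assms(1) by (simp add: square_integrable_def)
    have "(norm (g \<omega>))\<^sup>2 \<le> (c * norm (f \<omega>))\<^sup>2" if "\<omega> \<in> space M" for \<omega>
      using assms(3)[OF that] by (intro power_mono) auto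
    then show "AE \<omega> in M. norm ((norm (g \<omega>))\<^sup>2) \<le> norm (c\<^sup>2 * (norm (f \<omega>))\<^sup>2)"
      by (intro AE_I2) (simp add: power_mult_distrib)
  qed (use assms(2) in measurable)
qed (fact assms(2))

lemma integrable_inner:
  assumes "square_integrable M f" "square_integrable M g"
  shows "integrable M (\<lambda>\<omega>. f \<omega> \<bullet> g \<omega>)"
proof (rule Bochner_Integration.integrable_bound)
  show "integrable M (\<lambda>\<omega>. (norm (f \<omega>))\<^sup>2 + (norm (g \<omega>))\<^sup>2)"
    using assms by (simp add: square_integrable_def)
  have "\<bar>x \<bullet> y\<bar> \<le> (norm x)\<^sup>2 + (norm y)\<^sup>2" for x y :: 'b
    using Cauchy_Schwarz_ineq2[of x y] sum_squares_bound[of "norm x" "norm y"]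
      mult_nonneg_nonneg[of "norm x" "norm y"] by simp
  then show "AE \<omega> in M. norm (f \<omega> \<bullet> g \<omega>) \<le> norm ((norm (f \<omega>))\<^sup>2 + (norm (g \<omega>))\<^sup>2)"
    by (intro always_eventually) simp
qed (use assms in \<open>auto simp: square_integrable_def intro: borel_measurable_inner\<close>)

lemma (in prob_space) subalgebra_sigma_finite:
  assumes "subalgebra M F"
  shows "sigma_finite_subalgebra M F"
  using assms
  by (intro finite_measure_subalgebra_is_sigma_finite)
    (simp add: finite_measure_subalgebra_def finite_measure_subalgebra_axioms_def finite_measure_axioms)

text \<open>
  A conditionally centred vector is orthogonal in \<open>L\<^sup>2\<close> to every vector known at the time of conditioning;
  since the conditional expectation is taken componentwise, so is the argument.
\<close>

lemma (in prob_space) expectation_inner_cond_centred: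
  fixes e Y :: "'a \<Rightarrow> real^'p"
  assumes F: "subalgebra M F" and Y: "Y \<in> borel_measurable F" "square_integrable M Y"
    and e: "square_integrable M e" "AE \<omega> in M. vec_cond_exp M F e \<omega> = 0"
  shows "expectation (\<lambda>\<omega>. Y \<omega> \<bullet> e \<omega>) = 0"
proof -
  interpret S: sigma_finite_subalgebra M F by (rule subalgebra_sigma_finite[OF F])
  have em[measurable]: "e \<in> borel_measurable M" using e by (simp add: square_integrable_def)
  have nth: "(\<lambda>x::real^'p. x $ j) \<in> borel_measurable borel" for j
    by (intro borel_measurable_continuous_onI continuous_intros)
  have YF[measurable]: "(\<lambda>\<omega>. Y \<omega> $ j) \<in> borel_measurable F" for j
    using measurable_compose[OF Y(1) nth] .
  have ej[measurable]: "(\<lambda>\<omega>. e \<omega> $ j) \<in> borel_measurable M" for j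
    using measurable_compose[OF em nth] .
  have comp: "square_integrable M (\<lambda>\<omega>. f \<omega> $ j)" if "square_integrable M f" for f :: "'a \<Rightarrow> real^'p" and j
  proof (rule square_integrable_bounded_by[OF that, of _ 1])
    show "(\<lambda>\<omega>. f \<omega> $ j) \<in> borel_measurable M"
      using that measurable_compose[OF _ nth] unfolding square_integrable_def by blast
    show "norm (f \<omega> $ j) \<le> 1 * norm (f \<omega>)" for \<omega>
      using Finite_Cartesian_Product.norm_nth_le[of "f \<omega>" j] by simp
  qed
  have int: "integrable M (\<lambda>\<omega>. Y \<omega> $ j * e \<omega> $ j)" for j
    using integrable_inner[OF comp[OF Y(2), of j] comp[OF e(1), of j]] by simp
  have "expectation (\<lambda>\<omega>. Y \<omega> $ j * e \<omega> $ j) = 0" for j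
  proof -
    have "expectation (\<lambda>\<omega>. Y \<omega> $ j * e \<omega> $ j)
        = expectation (\<lambda>\<omega>. Y \<omega> $ j * real_cond_exp M F (\<lambda>\<omega>. e \<omega> $ j) \<omega>)"
      using S.real_cond_exp_intg(2)[OF int YF ej] by simp
    also have "AE \<omega> in M. real_cond_exp M F (\<lambda>\<omega>. e \<omega> $ j) \<omega> = 0"
      using e(2) by eventually_elim (simp add: vec_cond_exp_def vec_eq_iff)
    then have "expectation (\<lambda>\<omega>. Y \<omega> $ j * real_cond_exp M F (\<lambda>\<omega>. e \<omega> $ j) \<omega>) = 0"
      by (intro integral_eq_zero_AE) auto
    finally show ?thesis .
  qed
  then show ?thesis
    unfolding inner_vec_def inner_real_def
    by (subst Bochner_Integration.integral_sum) (auto intro: int)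
qed

lemma (in prob_space) expectation_norm_sq_cond_centred:
  fixes e Y :: "'a \<Rightarrow> real^'p"
  assumes F: "subalgebra M F" and Y: "Y \<in> borel_measurable F" "square_integrable M Y"
    and e: "square_integrable M e" "AE \<omega> in M. vec_cond_exp M F e \<omega> = 0"
  shows "expectation (\<lambda>\<omega>. (norm (Y \<omega> - c *\<^sub>R e \<omega>))\<^sup>2)
    = expectation (\<lambda>\<omega>. (norm (Y \<omega>))\<^sup>2) + c\<^sup>2 * expectation (\<lambda>\<omega>. (norm (e \<omega>))\<^sup>2)"
proof -
  have "(norm (Y \<omega> - c *\<^sub>R e \<omega>))\<^sup>2 = (norm (Y \<omega>))\<^sup>2 - 2 * c * (Y \<omega> \<bullet> e \<omega>) + c\<^sup>2 * (norm (e \<omega>))\<^sup>2" for \<omega>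
    unfolding power2_norm_eq_inner
    by (simp add: inner_diff_left inner_diff_right inner_commute power2_eq_square algebra_simps)
  moreover have "integrable M (\<lambda>\<omega>. (norm (Y \<omega>))\<^sup>2)" "integrable M (\<lambda>\<omega>. (norm (e \<omega>))\<^sup>2)"
    using Y e by (auto simp: square_integrable_def)
  ultimately show ?thesis
    using integrable_inner[OF Y(2) e(1)] expectation_inner_cond_centred[OF assms] by simp
qed

lemma integrable_and_integral_le:
  assumes "f \<in> borel_measurable M" "AE \<omega> in M. 0 \<le> f \<omega>" "(\<integral>\<^sup>+\<omega>. ennreal (f \<omega>) \<partial>M) \<le> ennreal b" "0 \<le> b"
  shows "integrable M f" "integral\<^sup>L M f \<le> b"
proof -
  show "integrable M f"
    using assms by (intro integrableI_nonneg) (auto simp: ennreal_less_top intro: le_less_trans)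
  then have "ennreal (integral\<^sup>L M f) \<le> ennreal b"
    using assms by (subst nn_integral_eq_integral[symmetric]) auto
  then show "integral\<^sup>L M f \<le> b" using assms(4) by (simp add: ennreal_le_iff)
qed

lemma (in prob_space) nn_integral_nn_cond_exp:
  assumes "subalgebra M F" "f \<in> borel_measurable M"
  shows "(\<integral>\<^sup>+\<omega>. nn_cond_exp M F f \<omega> \<partial>M) = (\<integral>\<^sup>+\<omega>. f \<omega> \<partial>M)"
proof -
  interpret S: sigma_finite_subalgebra M F by (rule subalgebra_sigma_finite[OF assms(1)])
  show ?thesis using S.nn_cond_exp_intg[of "\<lambda>_. 1" f] assms(2) by simp
qed

text \<open>
  Conditional expectations with values in \<^typ>\<open>ennreal\<close> can be compared before integrability is known.
  Integrating the comparison transfers integrability from \<open>h\<close> to \<open>f\<close>.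
\<close>

lemma (in prob_space) expectation_le_of_nn_cond_exp_le:
  assumes "subalgebra M F" and f: "f \<in> borel_measurable M" "AE \<omega> in M. 0 \<le> f \<omega>"
    and h: "integrable M h" "AE \<omega> in M. 0 \<le> h \<omega>"
    and le: "AE \<omega> in M. nn_cond_exp M F (\<lambda>\<omega>. ennreal (f \<omega>)) \<omega> \<le> nn_cond_exp M F (\<lambda>\<omega>. ennreal (h \<omega>)) \<omega>"
  shows "integrable M f" "expectation f \<le> expectation h"
proof -
  have "(\<integral>\<^sup>+\<omega>. ennreal (f \<omega>) \<partial>M) \<le> (\<integral>\<^sup>+\<omega>. ennreal (h \<omega>) \<partial>M)"
    using nn_integral_mono_AE[OF le] f(1) borel_measurable_integrable[OF h(1)]
    by (simp add: nn_integral_nn_cond_exp[OF assms(1)])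
  also have "\<dots> = ennreal (expectation h)" using h by (intro nn_integral_eq_integral) auto
  finally have *: "(\<integral>\<^sup>+\<omega>. ennreal (f \<omega>) \<partial>M) \<le> ennreal (expectation h)" .
  show "integrable M f" "expectation f \<le> expectation h"
    using integrable_and_integral_le[OF f *] integral_nonneg_AE[OF h(2)] by auto
qed

text \<open>
  The variant in which the bound is itself an integrable function: this is the form of the variance
  recursion, and it is what makes \<open>\<Delta>\<^sub>k\<close> integrable.
\<close>

lemma (in prob_space) expectation_le_of_nn_cond_exp_le_real:
  assumes "subalgebra M F" and f: "f \<in> borel_measurable M" "AE \<omega> in M. 0 \<le> f \<omega>"
    and h: "integrable M h" "AE \<omega> in M. 0 \<le> h \<omega>" and c: "c > 0"
    and le: "AE \<omega> in M. ennreal c * nn_cond_exp M F (\<lambda>\<omega>. ennreal (f \<omega>)) \<omega> \<le> ennreal (h \<omega>)"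
  shows "integrable M f" "c * expectation f \<le> expectation h"
proof -
  note fm[measurable] = f(1)
  interpret S: sigma_finite_subalgebra M F by (rule subalgebra_sigma_finite[OF assms(1)])
  have "(\<integral>\<^sup>+\<omega>. ennreal (c * f \<omega>) \<partial>M) = (\<integral>\<^sup>+\<omega>. ennreal c * ennreal (f \<omega>) \<partial>M)"
    using f(2) c by (intro nn_integral_cong_AE) (auto simp: ennreal_mult')
  also have "\<dots> = (\<integral>\<^sup>+\<omega>. ennreal c * nn_cond_exp M F (\<lambda>\<omega>. ennreal (f \<omega>)) \<omega> \<partial>M)"
    by (rule S.nn_cond_exp_intg[symmetric]) auto
  also have "\<dots> \<le> (\<integral>\<^sup>+\<omega>. ennreal (h \<omega>) \<partial>M)" by (rule nn_integral_mono_AE[OF le])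
  also have "\<dots> = ennreal (expectation h)" using h by (intro nn_integral_eq_integral) auto
  finally have *: "(\<integral>\<^sup>+\<omega>. ennreal (c * f \<omega>) \<partial>M) \<le> ennreal (expectation h)" .
  have "AE \<omega> in M. 0 \<le> c * f \<omega>" using f(2) by eventually_elim (use c in simp)
  then have **: "integrable M (\<lambda>\<omega>. c * f \<omega>)" "expectation (\<lambda>\<omega>. c * f \<omega>) \<le> expectation h"
    using integrable_and_integral_le[OF _ _ *] integral_nonneg_AE[OF h(2)] f c by auto
  then show "integrable M f" "c * expectation f \<le> expectation h" using c by auto
qed

lemma square_integrable_normD: "square_integrable M f \<Longrightarrow> integrable M (\<lambda>\<omega>. (norm (f \<omega>))\<^sup>2)"
  by (simp add: square_integrable_def)

section \<open>From recursions of the moments to rates\<close>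

text \<open>
  All conclusions about rates use only scalar moments. Here \<open>V\<close>, \<open>\<delta>\<close>, \<open>a\<close>, \<open>g\<close>, \<open>u\<close> and \<open>D\<close> stand for the
  expectations of the energy, of \<open>|d\<^sub>k|\<^sup>2\<close>, \<open>|v\<^sub>k|\<^sup>2\<close>, \<open>|Gx\<^sub>k|\<^sup>2\<close>, \<open>U\<^sub>k\<close> and \<open>\<Delta>\<^sub>k\<close>, and \<open>R\<close> for the
  squared initial distance. The recursions start at \<open>k = 1\<close>, after the first, noise-free step.
\<close>

locale vfkm_moments =
  fixes r L \<beta> \<rho> \<Theta> \<Theta>h R :: real and V \<delta> a g u D :: "nat \<Rightarrow> real"
  assumes r: "r > 2" and L: "L > 0"
    and \<beta>: "0 < \<beta>" "\<beta> < beta_bar r L \<rho> \<Theta> \<Theta>h"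
    and \<rho>: "0 < \<rho>" "\<rho> < 1" and \<Theta>: "0 < \<Theta>" "0 \<le> \<Theta>h"
    and nonneg: "\<And>k. 0 \<le> V k" "\<And>k. 0 \<le> \<delta> k" "\<And>k. 0 \<le> a k" "\<And>k. 0 \<le> g k"
      "\<And>k. 0 \<le> u k" "\<And>k. 0 \<le> D k"
    and init: "V 1 \<le> r * (r + 1) * R" "(r + 2)\<^sup>2 * \<delta> 1 \<le> 4 * \<beta>\<^sup>2 * r\<^sup>2 * L\<^sup>2 * R" "a 1 = 0" "u 0 = 0" "D 0 = 0"
    and energy_step: "\<And>k. k \<ge> 1 \<Longrightarrow> V (Suc k) \<le> V k - (2 * real k + r + 1) * \<delta> k
      - 4 * \<beta> * real k * (real k + r) * (1 / L - \<beta>) * u k + 4 * \<beta>\<^sup>2 * (real k + r)\<^sup>2 * D k"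
    and variance_step: "\<And>k. k \<ge> 1 \<Longrightarrow> (real k + r)\<^sup>2 * D k \<le> (1 - \<rho>) * (real k + r - 1)\<^sup>2 * D (k - 1)
      + \<Theta> * (real k + r)\<^sup>2 * u k + \<Theta>h * (real k + r - 1)\<^sup>2 * u (k - 1)"
    and residual_step: "\<And>k. k \<ge> 1 \<Longrightarrow> (real k + r + 2)\<^sup>2 * a (Suc k)
      \<le> ((real k + r + 1)\<^sup>2 - (r - 2) * (real k + r + 1)) * a k + (4 / r) * (real k + 3) * \<delta> k
        + 4 * \<beta>\<^sup>2 * (real k + r)\<^sup>2 * D k"
    and increment_step: "\<And>k. k \<ge> 1 \<Longrightarrow> (real k + r + 2)\<^sup>2 * \<delta> (Suc k)
      \<le> (real k + r + 1)\<^sup>2 * \<delta> k + 2 * \<beta>\<^sup>2 * r * (3 * real k + 2 * r) * g k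
        + 4 * \<beta>\<^sup>2 * (real k + r)\<^sup>2 * D k"
    and operator_le: "\<And>k. (2 * \<beta> * (real k + r) / (real k + r + 2))\<^sup>2 * g k \<le> 2 * \<delta> (Suc k) + 2 * a (Suc k)"
begin

abbreviation "\<Lambda> \<equiv> const_Lambda r L \<beta> \<rho> \<Theta> \<Theta>h"
abbreviation "\<psi> \<equiv> const_psi r L \<beta> \<rho> \<Theta> \<Theta>h"
abbreviation "C0 \<equiv> const_C0 r L \<beta>"
abbreviation "C1 \<equiv> const_C1 r L \<beta> \<rho> \<Theta> \<Theta>h"
abbreviation "C2 \<equiv> const_C2 r L \<beta> \<rho> \<Theta> \<Theta>h"
abbreviation "C3 \<equiv> const_C3 r L \<beta> \<rho> \<Theta> \<Theta>h"

lemma R_nonneg: "0 \<le> R"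
proof -
  have "0 \<le> r * (r + 1) * R" using nonneg(1)[of 1] init(1) by linarith
  moreover have "0 < r * (r + 1)" using r by simp
  ultimately show ?thesis using zero_le_mult_iff[of "r * (r + 1)" R] by linarith
qed

lemma Lambda_pos: "0 < \<Lambda>"
proof -
  have "0 < (\<rho> + (r + 1) * (\<Theta> + \<Theta>h)) * L" using \<rho> r \<Theta> L by (intro mult_pos_pos add_pos_nonneg) auto
  moreover have "\<beta> < \<rho> / ((\<rho> + (r + 1) * (\<Theta> + \<Theta>h)) * L)" using \<beta>(2) by (simp add: beta_bar_def)
  ultimately have "(\<rho> + (r + 1) * (\<Theta> + \<Theta>h)) * L * \<beta> < \<rho>" by (simp add: pos_less_divide_eq mult_ac)
  then show ?thesis unfolding const_Lambda_def using \<beta> L \<rho> r by (intro divide_pos_pos mult_pos_pos) auto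
qed

text \<open>
  \<open>\<Lambda>\<close> is what remains of the gain \<open>4\<beta>(1/L-\<beta>)/(r+1)\<close> in \<open>U\<^sub>k\<close> once the noise has been paid for.
\<close>

lemma Lambda_plus: "\<Lambda> + 4 * \<beta>\<^sup>2 * (\<Theta> + \<Theta>h) / \<rho> = 4 * \<beta> * (1 / L - \<beta>) / (r + 1)"
proof -
  have "r + 1 \<noteq> 0" using r by simp
  then show ?thesis unfolding const_Lambda_def using L \<rho>
    by (simp add: divide_simps) (simp add: algebra_simps power2_eq_square)
qed

lemma psi_nonneg: "0 \<le> \<psi>"
  using Lambda_pos \<rho> \<Theta> by (simp add: const_psi_def)

text \<open>
  Adding \<open>4\<beta>\<^sup>2(1-\<rho>)/\<rho>\<close> times the previous scaled variance to the energy works because one step of the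
  variance recursion turns \<open>4\<beta>\<^sup>2/\<rho>\<close> times the new variance into exactly this multiple of the old one; the
  \<open>\<Theta>h\<close> term in the potential carries the delayed \<open>U\<^sub>k\<^sub>-\<^sub>1\<close>.
\<close>

lemma energy_sum:
  "(\<Sum>k=1..K. (2 * real k + r + 1) * \<delta> k + \<Lambda> * ((real k + r)\<^sup>2 * u k)) \<le> r * (r + 1) * R"
proof -
  define W where "W k = V k + 4 * \<beta>\<^sup>2 * (1 - \<rho>) / \<rho> * ((real k + r - 1)\<^sup>2 * D (k - 1))
    + 4 * \<beta>\<^sup>2 * \<Theta>h / \<rho> * ((real k + r - 1)\<^sup>2 * u (k - 1))" for k
  have "W (Suc k) + ((2 * real k + r + 1) * \<delta> k + \<Lambda> * ((real k + r)\<^sup>2 * u k)) \<le> W k + 0" if k: "k \<ge> 1" for k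
  proof -
    have "(4 * \<beta>\<^sup>2 / \<rho>) * ((real k + r)\<^sup>2 * D k) \<le> (4 * \<beta>\<^sup>2 / \<rho>) * ((1 - \<rho>) * (real k + r - 1)\<^sup>2 * D (k - 1)
        + \<Theta> * (real k + r)\<^sup>2 * u k + \<Theta>h * (real k + r - 1)\<^sup>2 * u (k - 1))"
      using variance_step[OF k] \<rho> by (intro mult_left_mono) auto
    moreover have "(\<Lambda> + 4 * \<beta>\<^sup>2 * (\<Theta> + \<Theta>h) / \<rho>) * ((real k + r)\<^sup>2 * u k)
        \<le> 4 * \<beta> * real k * (real k + r) * (1 / L - \<beta>) * u k"
    proof -
      have L\<beta>: "0 \<le> 4 * \<beta> * (1 / L - \<beta>) / (r + 1)"
        using Lambda_pos \<rho> \<Theta> by (subst Lambda_plus[symmetric]) (intro add_nonneg_nonneg, auto)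
      have "r * 1 \<le> r * real k" using k r by (intro mult_left_mono) auto
      then have "(real k + r) * ((real k + r) * u k) \<le> ((r + 1) * real k) * ((real k + r) * u k)"
        using r nonneg(5)[of k] by (intro mult_right_mono) (auto simp: algebra_simps)
      from mult_left_mono[OF this L\<beta>]
      have "4 * \<beta> * (1 / L - \<beta>) / (r + 1) * ((real k + r) * ((real k + r) * u k))
          \<le> 4 * \<beta> * (1 / L - \<beta>) / (r + 1) * (r + 1) * (real k * ((real k + r) * u k))"
        by (simp only: mult.assoc)
      also have "4 * \<beta> * (1 / L - \<beta>) / (r + 1) * (r + 1) = 4 * \<beta> * (1 / L - \<beta>)" using r by simp
      finally show ?thesis unfolding Lambda_plus by (simp only: power2_eq_square mult_ac)
    qed
    moreover have "(4 * \<beta>\<^sup>2 / \<rho>) * ((real k + r)\<^sup>2 * D k) = 4 * \<beta>\<^sup>2 * (1 - \<rho>) / \<rho> * ((real k + r)\<^sup>2 * D k)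
        + 4 * \<beta>\<^sup>2 * (real k + r)\<^sup>2 * D k"
      using \<rho> by (simp add: field_simps)
    ultimately show ?thesis using energy_step[OF k] \<rho>
      unfolding W_def by (simp add: algebra_simps add_divide_distrib diff_divide_distrib)
  qed
  from telescope_bound[of W, OF this, of K]
  have "W (Suc K) + (\<Sum>k=1..K. (2 * real k + r + 1) * \<delta> k + \<Lambda> * ((real k + r)\<^sup>2 * u k)) \<le> V 1"
    using init by (simp add: W_def)
  moreover have "0 \<le> W (Suc K)" using nonneg \<rho> \<Theta> by (simp add: W_def)
  ultimately show ?thesis using init(1) by linarith
qed

lemma increment_sum: "(\<Sum>k=1..K. (2 * real k + r + 1) * \<delta> k) \<le> r * (r + 1) * R"
proof (rule order_trans[OF sum_mono energy_sum])
  show "(2 * real k + r + 1) * \<delta> k \<le> (2 * real k + r + 1) * \<delta> k + \<Lambda> * ((real k + r)\<^sup>2 * u k)" for k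
    using Lambda_pos nonneg(5) by simp
qed

text \<open>
  Summing the contraction of the variance bounds the total noise by the total of \<open>(k+r)\<^sup>2U\<^sub>k\<close>, which the
  energy controls with factor \<open>1/\<Lambda>\<close>. The product of the two factors is \<open>\<psi>\<close>.
\<close>

lemma noise_sum: "(\<Sum>k=1..K. 4 * \<beta>\<^sup>2 * (real k + r)\<^sup>2 * D k) \<le> \<psi> * (r * (r + 1) * R)"
proof -
  define W where "W k = (1 - \<rho>) * ((real k + r - 1)\<^sup>2 * D (k - 1)) + \<Theta>h * ((real k + r - 1)\<^sup>2 * u (k - 1))" for k
  let ?u = "\<Sum>k=1..K. (real k + r)\<^sup>2 * u k" and ?D = "\<Sum>k=1..K. (real k + r)\<^sup>2 * D k"
  have "W (Suc k) + \<rho> * ((real k + r)\<^sup>2 * D k) \<le> W k + (\<Theta> + \<Theta>h) * ((real k + r)\<^sup>2 * u k)" if "k \<ge> 1" for k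
    using variance_step[OF that] by (simp add: W_def algebra_simps)
  from telescope_bound[of W, OF this, of K]
  have "W (Suc K) + \<rho> * ?D \<le> W 1 + (\<Theta> + \<Theta>h) * ?u" by (simp only: sum_distrib_left)
  moreover have "0 \<le> W (Suc K)" "W 1 = 0" using init nonneg \<rho> \<Theta> by (auto simp: W_def)
  ultimately have 1: "\<rho> * ?D \<le> (\<Theta> + \<Theta>h) * ?u" by linarith
  have "\<Lambda> * ?u \<le> r * (r + 1) * R"
    unfolding sum_distrib_left using nonneg r
    by (intro order_trans[OF sum_mono energy_sum]) simp
  then have "?u \<le> r * (r + 1) * R / \<Lambda>" using Lambda_pos by (simp add: field_simps)
  then have "(\<Theta> + \<Theta>h) * ?u \<le> (\<Theta> + \<Theta>h) * (r * (r + 1) * R / \<Lambda>)" using \<Theta> by (intro mult_left_mono) auto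
  with 1 have "?D * \<rho> \<le> (\<Theta> + \<Theta>h) * (r * (r + 1) * R / \<Lambda>)" by (simp only: mult.commute[of _ \<rho>])
  then have "?D \<le> (\<Theta> + \<Theta>h) * (r * (r + 1) * R / \<Lambda>) / \<rho>" by (simp only: pos_le_divide_eq[OF \<rho>(1)])
  then have "4 * \<beta>\<^sup>2 * ?D \<le> 4 * \<beta>\<^sup>2 * ((\<Theta> + \<Theta>h) * (r * (r + 1) * R / \<Lambda>) / \<rho>)"
    by (intro mult_left_mono) auto
  then show ?thesis by (simp add: const_psi_def sum_distrib_left mult_ac)
qed

text \<open>
  The factor of two is what \<open>residual_sum\<close> spends when it bounds \<open>4/r\<close> times the energy by the summand
  \<open>2/r * C\<^sub>0\<close> of \<open>C\<^sub>1\<close>.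
\<close>

lemma two_energy_le: "2 * (r * (r + 1) * R) \<le> C0 * R"
proof -
  have "2 * (r * (r + 1)) \<le> C0" unfolding const_C0_def
  proof -
    have "r * (2 * (r + 1)) \<le> r * (1 + 3 * r + 8 * r * L\<^sup>2 * \<beta>\<^sup>2)"
      using r by (intro mult_left_mono) (auto intro: add_increasing2)
    then show "2 * (r * (r + 1)) \<le> r * (1 + 3 * r + 8 * r * L\<^sup>2 * \<beta>\<^sup>2)"
      by (simp only: mult.left_commute)
  qed
  then show ?thesis using R_nonneg mult_right_mono by fastforce
qed

lemma energy_le: "r * (r + 1) * R \<le> C0 * R"
proof -
  have "0 \<le> r * (r + 1) * R" using r R_nonneg by simp
  with two_energy_le show ?thesis by linarith
qed

lemma noise_sum_le: "(\<Sum>k=1..K. 4 * \<beta>\<^sup>2 * (real k + r)\<^sup>2 * D k) \<le> \<psi> * (C0 * R)"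
  using order_trans[OF noise_sum mult_left_mono[OF energy_le psi_nonneg]] .

text \<open>
  The telescoped residual recursion. It yields a pointwise and a summed bound at the same time, because
  every step gives up \<open>(r-2)(k+r+1)\<close> times the squared residual.
\<close>

lemma residual_sum:
  "(real K + r + 2)\<^sup>2 * a (Suc K) + (r - 2) * (\<Sum>k=1..K. (real k + r + 1) * a k) \<le> C1 * R"
proof -
  have *: "(real (Suc k) + r + 1)\<^sup>2 * a (Suc k) + (r - 2) * ((real k + r + 1) * a k)
    \<le> (real k + r + 1)\<^sup>2 * a k + ((4 / r) * ((2 * real k + r + 1) * \<delta> k) + 4 * \<beta>\<^sup>2 * (real k + r)\<^sup>2 * D k)"
    if "k \<ge> 1" for k
  proof -
    \<comment> \<open>\<open>k+3 \<le> 2k+r+1\<close> since \<open>k \<ge> 1\<close> and \<open>r > 2\<close>; the right-hand weight is the one summed by the energy\<close>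
    have "(4 / r) * ((real k + 3) * \<delta> k) \<le> (4 / r) * ((2 * real k + r + 1) * \<delta> k)"
      using r that nonneg(2)[of k] by (intro mult_left_mono mult_right_mono) auto
    moreover have "real (Suc k) + r + 1 = real k + r + 2" by simp
    ultimately show ?thesis
      using residual_step[OF that] by (simp only: left_diff_distrib mult.assoc)
  qed
  have "(real K + r + 2)\<^sup>2 * a (Suc K) + (r - 2) * (\<Sum>k=1..K. (real k + r + 1) * a k)
      \<le> (4 / r) * (\<Sum>k=1..K. (2 * real k + r + 1) * \<delta> k) + (\<Sum>k=1..K. 4 * \<beta>\<^sup>2 * (real k + r)\<^sup>2 * D k)"
    using telescope_bound[of "\<lambda>k. (real k + r + 1)\<^sup>2 * a k", OF *, of K] init
    by (simp add: sum.distrib sum_distrib_left add_ac)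
  also have "\<dots> \<le> (4 / r) * (r * (r + 1) * R) + \<psi> * (C0 * R)"
    using r by (intro add_mono mult_left_mono increment_sum noise_sum_le) auto
  also have "\<dots> = (2 / r) * (2 * (r * (r + 1) * R)) + \<psi> * (C0 * R)" by simp
  also have "\<dots> \<le> (2 / r) * (C0 * R) + \<psi> * (C0 * R)"
    using mult_left_mono[OF two_energy_le, of "2 / r"] r by simp
  also have "\<dots> \<le> C1 * R"
  proof -
    have "0 \<le> 4 * r\<^sup>2 * (r - 1) * L\<^sup>2 * \<beta>\<^sup>2 / (r + 2)"
      using r by (intro divide_nonneg_nonneg mult_nonneg_nonneg) auto
    then have "((2 / r + \<psi>) * C0) * R \<le> C1 * R"
      using R_nonneg by (intro mult_right_mono) (simp_all add: const_C1_def)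
    then show ?thesis by (simp only: distrib_right mult.assoc)
  qed
  finally show ?thesis .
qed

lemma residual_le: "(real k + r + 2)\<^sup>2 * a (Suc k) \<le> C1 * R"
proof -
  have "0 \<le> (r - 2) * (\<Sum>k=1..k. (real k + r + 1) * a k)"
    using r nonneg by (intro mult_nonneg_nonneg sum_nonneg) auto
  with residual_sum[of k] show ?thesis by linarith
qed

lemma residual_weighted_sum: "(\<Sum>k=1..K. (2 * real k + r + 1) * a k) \<le> 2 * C1 / (r - 2) * R"
proof -
  have "(r - 2) * (\<Sum>k=1..K. (real k + r + 1) * a k) \<le> C1 * R"
    using residual_sum[of K] nonneg(3)[of "Suc K"] by (smt (verit) mult_nonneg_nonneg zero_le_power2)
  then have "2 * (\<Sum>k=1..K. (real k + r + 1) * a k) \<le> 2 * C1 / (r - 2) * R"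
    using r by (simp add: field_simps)
  moreover have "(\<Sum>k=1..K. (2 * real k + r + 1) * a k) \<le> (\<Sum>k=1..K. 2 * ((real k + r + 1) * a k))"
    using r nonneg(3) by (intro sum_mono) (simp add: algebra_simps)
  ultimately show ?thesis by (simp add: sum_distrib_left)
qed

lemma operator_le_scaled:
  "2 * \<beta>\<^sup>2 * (real k + r)\<^sup>2 * g k \<le> (real k + r + 2)\<^sup>2 * \<delta> (Suc k) + (real k + r + 2)\<^sup>2 * a (Suc k)"
proof -
  have "real k + r + 2 \<noteq> 0" using r by simp
  then have "(2 * \<beta> * (real k + r) / (real k + r + 2))\<^sup>2 * g k * (real k + r + 2)\<^sup>2 = 4 * \<beta>\<^sup>2 * (real k + r)\<^sup>2 * g k"
    by (simp add: power_divide power_mult_distrib)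
  with mult_right_mono[OF operator_le[of k], of "(real k + r + 2)\<^sup>2"]
  have "4 * \<beta>\<^sup>2 * (real k + r)\<^sup>2 * g k \<le> (2 * \<delta> (Suc k) + 2 * a (Suc k)) * (real k + r + 2)\<^sup>2" by simp
  then show ?thesis by (simp add: algebra_simps)
qed

text \<open>
  \<open>\<eta>\<^sub>k\<close> increases with \<open>k\<close>, so \<open>\<eta>\<^sub>0 = 2\<beta>r/(r+2)\<close> may replace it.
\<close>

lemma operator_le_uniform: "g k \<le> (r + 2)\<^sup>2 / (2 * \<beta>\<^sup>2 * r\<^sup>2) * (\<delta> (Suc k) + a (Suc k))"
proof -
  have "2 * \<beta> * r / (r + 2) \<le> 2 * \<beta> * (real k + r) / (real k + r + 2)"
    using r \<beta> by (simp add: divide_simps) (simp add: algebra_simps)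
  then have "(2 * \<beta> * r / (r + 2))\<^sup>2 * g k \<le> (2 * \<beta> * (real k + r) / (real k + r + 2))\<^sup>2 * g k"
    using r \<beta> nonneg by (intro mult_right_mono power_mono) auto
  with operator_le[of k] have "(2 * \<beta> * r / (r + 2))\<^sup>2 * g k \<le> 2 * (\<delta> (Suc k) + a (Suc k))" by simp
  then show ?thesis using r \<beta> by (simp add: power_divide power_mult_distrib field_simps)
qed

lemma increment_sum_Suc: "(\<Sum>k<K. (2 * real k + r + 3) * \<delta> (Suc k)) \<le> r * (r + 1) * R"
  using increment_sum[of K] by (simp add: sum.atLeast1_atMost_eq algebra_simps)

lemma operator_sum:
  "(\<Sum>k<K. (2 * real k + r + 3) * g k) \<le> (r + 2)\<^sup>2 / (2 * \<beta>\<^sup>2 * r\<^sup>2) * (C0 + 2 * C1 / (r - 2)) * R"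
proof -
  let ?c = "(r + 2)\<^sup>2 / (2 * \<beta>\<^sup>2 * r\<^sup>2)"
  have "(\<Sum>k<K. (2 * real k + r + 3) * g k)
      \<le> (\<Sum>k<K. (2 * real k + r + 3) * (?c * (\<delta> (Suc k) + a (Suc k))))"
    using r by (intro sum_mono mult_left_mono operator_le_uniform) auto
  also have "\<dots> = ?c * ((\<Sum>k<K. (2 * real k + r + 3) * \<delta> (Suc k)) + (\<Sum>k<K. (2 * real k + r + 3) * a (Suc k)))"
    unfolding sum.distrib[symmetric] sum_distrib_left
    by (intro sum.cong refl) algebra
  also have "\<dots> \<le> ?c * (C0 * R + 2 * C1 / (r - 2) * R)"
  proof (intro mult_left_mono add_mono)
    show "(\<Sum>k<K. (2 * real k + r + 3) * \<delta> (Suc k)) \<le> C0 * R"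
      using increment_sum_Suc energy_le by (rule order_trans)
    show "(\<Sum>k<K. (2 * real k + r + 3) * a (Suc k)) \<le> 2 * C1 / (r - 2) * R"
      using residual_weighted_sum[of K] by (simp add: sum.atLeast1_atMost_eq algebra_simps)
  qed simp
  finally show ?thesis by (simp only: distrib_right mult.assoc)
qed

text \<open>
  The weight \<open>3k+2r\<close> of \<open>|Gx\<^sub>k|\<^sup>2\<close> in one step is at most twice the weight \<open>2k+r+3\<close> for which the sum is
  already bounded.
\<close>

lemma increment_le: "(real k + r + 2)\<^sup>2 * \<delta> (Suc k) \<le> C2 * R"
proof -
  have step: "(real (Suc j) + r + 1)\<^sup>2 * \<delta> (Suc j) + 0
    \<le> (real j + r + 1)\<^sup>2 * \<delta> j + (4 * \<beta>\<^sup>2 * r * ((2 * real j + r + 3) * g j) + 4 * \<beta>\<^sup>2 * (real j + r)\<^sup>2 * D j)"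
    if "j \<ge> 1" for j
  proof -
    have "(2 * \<beta>\<^sup>2 * r) * ((3 * real j + 2 * r) * g j) \<le> (2 * \<beta>\<^sup>2 * r) * ((2 * (2 * real j + r + 3)) * g j)"
      using r nonneg(4)[of j] by (intro mult_left_mono mult_right_mono) auto
    then show ?thesis using increment_step[OF that] by (simp add: algebra_simps)
  qed
  have gsum: "(\<Sum>j=1..k. (2 * real j + r + 3) * g j) \<le> (r + 2)\<^sup>2 / (2 * \<beta>\<^sup>2 * r\<^sup>2) * (C0 + 2 * C1 / (r - 2)) * R"
    using r nonneg
    by (intro order_trans[OF sum_mono2 operator_sum[of "Suc k"]]) auto
  have "(real k + r + 2)\<^sup>2 * \<delta> (Suc k) \<le> (r + 2)\<^sup>2 * \<delta> 1
      + (4 * \<beta>\<^sup>2 * r * (\<Sum>j=1..k. (2 * real j + r + 3) * g j) + (\<Sum>j=1..k. 4 * \<beta>\<^sup>2 * (real j + r)\<^sup>2 * D j))"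
    using telescope_bound[of "\<lambda>j. (real j + r + 1)\<^sup>2 * \<delta> j", OF step, of k]
    by (simp add: sum.distrib sum_distrib_left add_ac)
  also have "\<dots> \<le> 4 * \<beta>\<^sup>2 * r\<^sup>2 * L\<^sup>2 * R
      + (4 * \<beta>\<^sup>2 * r * ((r + 2)\<^sup>2 / (2 * \<beta>\<^sup>2 * r\<^sup>2) * (C0 + 2 * C1 / (r - 2)) * R) + \<psi> * (C0 * R))"
    using r by (intro add_mono init mult_left_mono gsum noise_sum_le) auto
  also have "4 * \<beta>\<^sup>2 * r * ((r + 2)\<^sup>2 / (2 * \<beta>\<^sup>2 * r\<^sup>2) * (C0 + 2 * C1 / (r - 2)) * R)
      = 2 * (r + 2)\<^sup>2 / r * (C0 + 2 * C1 / (r - 2)) * R"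
    using r \<beta> by (simp add: power2_eq_square)
  also have "4 * \<beta>\<^sup>2 * r\<^sup>2 * L\<^sup>2 * R + (2 * (r + 2)\<^sup>2 / r * (C0 + 2 * C1 / (r - 2)) * R + \<psi> * (C0 * R)) = C2 * R"
    using r by (simp add: const_C2_def field_simps)
  finally show ?thesis .
qed

lemma operator_rate: "g k \<le> C3 * R / (\<beta>\<^sup>2 * (real k + r - 1) * (real k + r + 2))"
proof -
  let ?q = "(real k + r + 2)\<^sup>2"
  have q: "?q > 0" using r by simp
  have "\<delta> (Suc k) + a (Suc k) \<le> (C1 + C2) * R / ?q"
    using increment_le[of k] residual_le[of k] q by (simp add: field_simps)
  then have "(r + 2)\<^sup>2 / (2 * \<beta>\<^sup>2 * r\<^sup>2) * (\<delta> (Suc k) + a (Suc k))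
      \<le> (r + 2)\<^sup>2 / (2 * \<beta>\<^sup>2 * r\<^sup>2) * ((C1 + C2) * R / ?q)"
    by (intro mult_left_mono) auto
  also have "\<dots> = C3 * R / (\<beta>\<^sup>2 * ?q)" by (simp add: const_C3_def mult_ac)
  finally have *: "g k \<le> C3 * R / (\<beta>\<^sup>2 * ?q)" using operator_le_uniform[of k] by linarith
  then have "0 \<le> C3 * R / (\<beta>\<^sup>2 * ?q)" using nonneg(4)[of k] by linarith
  moreover have "0 < \<beta>\<^sup>2 * ?q" using q \<beta> by simp
  ultimately have C3R: "0 \<le> C3 * R" by (simp only: pos_le_divide_eq mult_zero_left)
  have "C3 * R / (\<beta>\<^sup>2 * ?q) \<le> C3 * R / (\<beta>\<^sup>2 * (real k + r - 1) * (real k + r + 2))"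
  proof (intro divide_left_mono C3R)
    show "\<beta>\<^sup>2 * (real k + r - 1) * (real k + r + 2) \<le> \<beta>\<^sup>2 * ?q"
      unfolding power2_eq_square[of "real k + r + 2"] mult.assoc
      using r by (intro mult_left_mono mult_right_mono) auto
  qed (use r \<beta> in auto)
  with * show ?thesis by linarith
qed

text \<open>
  Since \<open>r > 2\<close>, the denominator in the rate is at least \<open>\<beta>\<^sup>2(k+1)\<^sup>2\<close>.
\<close>

lemma operator_complexity: "\<exists>C>0. \<forall>\<epsilon>>0. \<exists>K::nat. real K \<le> C / \<epsilon> \<and> (\<forall>k\<ge>K. g k \<le> \<epsilon>\<^sup>2)"
proof (rule reciprocal_square_decay_complexity)
  have "0 < \<beta>\<^sup>2 * (real 0 + r - 1) * (real 0 + r + 2)" using r \<beta> by simp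
  from order_trans[OF nonneg(4) operator_rate[of 0], unfolded pos_le_divide_eq[OF this]]
  have C3R: "0 \<le> C3 * R" by (simp only: mult_zero_left)
  then show "0 \<le> C3 * R / \<beta>\<^sup>2" by simp
  fix k
  have "C3 * R / (\<beta>\<^sup>2 * (real k + r - 1) * (real k + r + 2)) \<le> C3 * R / (\<beta>\<^sup>2 * (real k + 1)\<^sup>2)"
  proof (intro divide_left_mono C3R)
    show "\<beta>\<^sup>2 * (real k + 1)\<^sup>2 \<le> \<beta>\<^sup>2 * (real k + r - 1) * (real k + r + 2)"
      unfolding power2_eq_square[of "real k + 1"] mult.assoc
      using r by (intro mult_left_mono mult_mono) auto
  qed (use r \<beta> in auto)
  with operator_rate[of k] show "g k \<le> C3 * R / \<beta>\<^sup>2 / (real k + 1)\<^sup>2" by simp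
qed

lemma noise_summable: "summable (\<lambda>k. 4 * \<beta>\<^sup>2 * (real (Suc k) + r)\<^sup>2 * D (Suc k))"
  using noise_sum_le nonneg
  by (intro summableI_nonneg_bounded[where x = "\<psi> * (C0 * R)"]) (auto simp: sum.atLeast1_atMost_eq)

lemma increment_summable: "summable (\<lambda>k. (2 * real k + r + 3) * \<delta> (Suc k))"
  using increment_sum_Suc nonneg r by (intro summableI_nonneg_bounded) auto

lemma operator_summable: "summable (\<lambda>k. (2 * real k + r + 3) * g k)"
  using operator_sum nonneg r by (intro summableI_nonneg_bounded) auto

lemma residual_summable: "summable (\<lambda>k. (2 * real k + r + 3) * a (Suc k))"
proof (rule summableI_nonneg_bounded)
  show "(\<Sum>k<K. (2 * real k + r + 3) * a (Suc k)) \<le> 2 * C1 / (r - 2) * R" for K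
    using residual_weighted_sum[of K] by (simp add: sum.atLeast1_atMost_eq algebra_simps)
qed (use nonneg r in auto)

lemma increment_scaled_tendsto_0: "(\<lambda>k. (real k + (r + 2))\<^sup>2 * \<delta> (Suc k)) \<longlonglongrightarrow> 0"
proof (rule quasi_decreasing_tendsto_0)
  let ?c = "\<lambda>k. 2 * \<beta>\<^sup>2 * r * (3 * real (Suc k) + 2 * r) * g (Suc k)"
  have "summable (\<lambda>k. (4 * \<beta>\<^sup>2 * r) * ((2 * real (Suc k) + r + 3) * g (Suc k)))"
    using operator_summable by (subst (asm) summable_Suc_iff[symmetric]) (rule summable_mult)
  moreover have "norm (?c k) \<le> (4 * \<beta>\<^sup>2 * r) * ((2 * real (Suc k) + r + 3) * g (Suc k))" for k
  proof -
    have "(2 * \<beta>\<^sup>2 * r) * ((3 * real (Suc k) + 2 * r) * g (Suc k))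
        \<le> (2 * \<beta>\<^sup>2 * r) * ((2 * (2 * real (Suc k) + r + 3)) * g (Suc k))"
      using r nonneg(4)[of "Suc k"] by (intro mult_left_mono mult_right_mono) auto
    then show ?thesis using r nonneg(4)[of "Suc k"] by (simp add: algebra_simps)
  qed
  ultimately have "summable ?c" by (rule summable_comparison_test'[where N = 0])
  then show "summable (\<lambda>k. ?c k + 4 * \<beta>\<^sup>2 * (real (Suc k) + r)\<^sup>2 * D (Suc k))"
    using noise_summable by (rule summable_add)
  show "0 \<le> ?c k + 4 * \<beta>\<^sup>2 * (real (Suc k) + r)\<^sup>2 * D (Suc k)" for k
    using r nonneg by simp
  show "(real (Suc k) + (r + 2))\<^sup>2 * \<delta> (Suc (Suc k))
      \<le> (real k + (r + 2))\<^sup>2 * \<delta> (Suc k) + (?c k + 4 * \<beta>\<^sup>2 * (real (Suc k) + r)\<^sup>2 * D (Suc k))" for k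
    using increment_step[of "Suc k"] by (simp add: add_ac)
  show "summable (\<lambda>k. (real k + (r + 2)) * \<delta> (Suc k))"
    using increment_summable
    by (rule summable_comparison_test'[where N = 0]) (use r nonneg in \<open>auto intro!: mult_right_mono\<close>)
qed (use r nonneg in auto)

lemma residual_scaled_tendsto_0: "(\<lambda>k. (real k + (r + 2))\<^sup>2 * a (Suc k)) \<longlonglongrightarrow> 0"
proof (rule quasi_decreasing_tendsto_0)
  let ?c = "\<lambda>k. (4 / r) * ((2 * real k + r + 3) * \<delta> (Suc k)) + 4 * \<beta>\<^sup>2 * (real (Suc k) + r)\<^sup>2 * D (Suc k)"
  show "summable ?c"
    by (intro summable_add summable_mult increment_summable noise_summable)
  show "0 \<le> ?c k" for k using r nonneg by simp
  show "(real (Suc k) + (r + 2))\<^sup>2 * a (Suc (Suc k)) \<le> (real k + (r + 2))\<^sup>2 * a (Suc k) + ?c k" for k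
  proof -
    have "(4 / r) * ((real (Suc k) + 3) * \<delta> (Suc k)) \<le> (4 / r) * ((2 * real k + r + 3) * \<delta> (Suc k))"
      using r nonneg(2)[of "Suc k"] by (intro mult_left_mono mult_right_mono) auto
    moreover have "((real (Suc k) + r + 1)\<^sup>2 - (r - 2) * (real (Suc k) + r + 1)) * a (Suc k)
        \<le> (real (Suc k) + r + 1)\<^sup>2 * a (Suc k)"
      using r nonneg(3)[of "Suc k"] by (intro mult_right_mono) auto
    moreover have "real (Suc k) + r + 1 = real k + (r + 2)" "real (Suc k) + r + 2 = real (Suc k) + (r + 2)"
      by simp_all
    ultimately show ?thesis
      using residual_step[of "Suc k"] by (simp only: mult.assoc) linarith
  qed
  show "summable (\<lambda>k. (real k + (r + 2)) * a (Suc k))"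
    using residual_summable
    by (rule summable_comparison_test'[where N = 0]) (use r nonneg in \<open>auto intro!: mult_right_mono\<close>)
qed (use r nonneg in auto)

lemma increment_tendsto_0: "(\<lambda>k. (real k)\<^sup>2 * \<delta> (Suc k)) \<longlonglongrightarrow> 0"
proof (rule tendsto_sandwich[OF _ _ tendsto_const increment_scaled_tendsto_0])
  show "\<forall>\<^sub>F k in sequentially. (real k)\<^sup>2 * \<delta> (Suc k) \<le> (real k + (r + 2))\<^sup>2 * \<delta> (Suc k)"
    using r nonneg by (intro always_eventually allI mult_right_mono power_mono) auto
qed (use nonneg in auto)

lemma operator_tendsto_0: "(\<lambda>k. (real k)\<^sup>2 * g k) \<longlonglongrightarrow> 0"
proof (rule tendsto_sandwich[OF _ _ tendsto_const])
  let ?b = "\<lambda>k. (1 / (2 * \<beta>\<^sup>2)) * ((real k + (r + 2))\<^sup>2 * \<delta> (Suc k) + (real k + (r + 2))\<^sup>2 * a (Suc k))"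
  have "?b \<longlonglongrightarrow> (1 / (2 * \<beta>\<^sup>2)) * (0 + 0)"
    by (intro tendsto_intros increment_scaled_tendsto_0 residual_scaled_tendsto_0)
  then show "?b \<longlonglongrightarrow> 0" by simp
  have "(real k)\<^sup>2 * g k \<le> ?b k" for k
  proof -
    have "(real k)\<^sup>2 * g k \<le> (real k + r)\<^sup>2 * g k"
      using r nonneg by (intro mult_right_mono power_mono) auto
    also have "\<dots> = (1 / (2 * \<beta>\<^sup>2)) * (2 * \<beta>\<^sup>2 * (real k + r)\<^sup>2 * g k)" using \<beta> by simp
    also have "\<dots> \<le> ?b k"
      using operator_le_scaled[of k] by (intro mult_left_mono) (auto simp: add_ac)
    finally show ?thesis .
  qed
  then show "\<forall>\<^sub>F k in sequentially. (real k)\<^sup>2 * g k \<le> ?b k" by simp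
qed (use nonneg in auto)

end

section \<open>Moments of the stochastic method\<close>

locale vfkm_run = prob_space M for M :: "'w measure" +
  fixes F :: "nat \<Rightarrow> 'w measure" and n :: nat and G :: "nat \<Rightarrow> real^'p \<Rightarrow> real^'p"
    and L r \<beta> \<rho> \<Theta> \<Theta>h :: real and \<theta> \<gamma> \<eta> :: "nat \<Rightarrow> real" and x0 xs :: "real^'p"
    and x St :: "nat \<Rightarrow> 'w \<Rightarrow> real^'p" and \<Delta> :: "nat \<Rightarrow> 'w \<Rightarrow> real"
  assumes n: "n \<ge> 1" and L: "L > 0" and cocoercive: "avg_cocoercive n G L" and r: "r > 2"
    and \<beta>: "0 < \<beta>" "\<beta> < beta_bar r L \<rho> \<Theta> \<Theta>h"
    and \<theta>: "\<And>k. \<theta> k = real k / (real k + r + 2)"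
    and \<gamma>: "\<And>k. \<gamma> k = real k / (real k + r)"
    and \<eta>: "\<And>k. \<eta> k = 2 * \<beta> * (real k + r) / (real k + r + 2)"
    and iterates: "vfkm_iterates M n G \<theta> \<gamma> \<eta> x0 x St"
    and filtr: "vfkm_filtration M F x \<Delta>"
    and estimator: "vr_unbiased_estimator M F n G \<gamma> x St \<rho> \<Theta> \<Theta>h \<Delta>"
    and \<Delta>0: "AE \<omega> in M. \<Delta> 0 \<omega> = 0"
    and xs: "xs \<in> zer (avg_map n G)"
begin

abbreviation "A \<equiv> avg_map n G"

definition "incr k \<omega> = x k \<omega> - x (k - 1) \<omega>"

definition "err k \<omega> = St k \<omega> - vfkm_S n G \<gamma> x k \<omega>"

text \<open>
  The part of \<open>(k+r+2) d\<^sub>k\<^sub>+\<^sub>1\<close> that is known before the estimator is drawn.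
\<close>

definition "drift k \<omega> = real k *\<^sub>R incr k \<omega>
  - (2 * \<beta>) *\<^sub>R ((real k + r) *\<^sub>R A (x k \<omega>) - real k *\<^sub>R A (x (k - 1) \<omega>))"

text \<open>
  Shifted to \<open>k+1\<close> this is \<open>d\<^sub>k\<^sub>+\<^sub>1 + \<eta>\<^sub>k G x\<^sub>k\<close>, the part of the increment not explained by the operator at the
  last iterate; it vanishes after the first step.
\<close>

definition "resid k \<omega> = incr k \<omega> + (2 * \<beta> * (real k + r - 1) / (real k + r + 1)) *\<^sub>R A (x (k - 1) \<omega>)"

definition "gap k \<omega> = A (x k \<omega>) \<bullet> (x k \<omega> - xs) - \<beta> * (norm (A (x k \<omega>)))\<^sup>2"

definition "energy k \<omega> = (norm (r *\<^sub>R (x (k - 1) \<omega> - xs) + (real k + r + 1) *\<^sub>R incr k \<omega>))\<^sup>2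
  + r * (norm (x (k - 1) \<omega> - xs))\<^sup>2 + 4 * \<beta> * r * real k * gap (k - 1) \<omega>"

lemma params: "0 < \<rho>" "\<rho> < 1" "0 < \<Theta>" "0 \<le> \<Theta>h"
  using estimator by (auto simp: vr_unbiased_estimator_def)

lemma beta_le: "\<beta> * ((r + 1) * L) \<le> 1" "\<beta> \<le> 1 / L"
proof -
  have "\<beta> < 1 / ((r + 1) * L)" using \<beta>(2) by (simp add: beta_bar_def)
  then show *: "\<beta> * ((r + 1) * L) \<le> 1" using r L by (simp add: pos_less_divide_eq)
  have "\<beta> * L * 1 \<le> \<beta> * L * (r + 1)" using r L \<beta> by (intro mult_left_mono) auto
  with * have "\<beta> * L \<le> 1" by (simp add: mult_ac)
  then show "\<beta> \<le> 1 / L" using L by (simp add: field_simps)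
qed

lemma A_xs: "A xs = 0"
  using xs by (simp add: zer_def)

lemma norm_A_le: "norm (A y) \<le> L * norm (y - xs)"
  using avg_map_lipschitz[OF n cocoercive L, of y xs] by (simp add: A_xs)

lemma gap_nonneg: "0 \<le> gap k \<omega>"
proof -
  have "(norm (A (x k \<omega>)))\<^sup>2 \<le> L * (A (x k \<omega>) \<bullet> (x k \<omega> - xs))"
    using order_trans[OF norm_avg_map_diff_le[OF n] avg_cocoerciveD[OF cocoercive L], of "x k \<omega>" xs]
    by (simp add: A_xs)
  then have "\<beta> * (norm (A (x k \<omega>)))\<^sup>2 \<le> (1 / L) * (L * (A (x k \<omega>) \<bullet> (x k \<omega> - xs)))"
    using \<beta> beta_le L by (intro mult_mono) auto
  then show ?thesis using L by (simp add: gap_def)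
qed

lemma energy_nonneg: "0 \<le> energy k \<omega>"
  unfolding energy_def using gap_nonneg r \<beta> by (intro add_nonneg_nonneg mult_nonneg_nonneg) auto

lemma subalgebra: "subalgebra M (F k)"
  using filtr by (simp add: vfkm_filtration_def)

lemma x_measurable_F: "j \<le> k \<Longrightarrow> x j \<in> borel_measurable (F k)"
proof -
  assume "j \<le> k"
  moreover have filt: "filtration (space M) F" and xj: "x j \<in> borel_measurable (F j)"
    using filtr by (auto simp: vfkm_filtration_def)
  ultimately have "subalgebra (F k) (F j)"
    by (simp add: subalgebra_def filtration.space_F[OF filt] filtration.sets_F_mono[OF filt])
  then show ?thesis using xj by (rule measurable_from_subalg)
qed

lemma x_measurable [measurable]: "x k \<in> borel_measurable M"
  using measurable_from_subalg[OF subalgebra x_measurable_F[OF order_refl]] .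

lemma A_measurable [measurable]: "A \<in> borel_measurable borel"
  by (rule borel_measurable_continuous_onI[OF avg_map_continuous[OF n cocoercive L]])

lemma U_measurable [measurable]: "vfkm_U n G x k \<in> borel_measurable M"
proof -
  have [measurable]: "(\<lambda>\<omega>. G i (x j \<omega>)) \<in> borel_measurable M" if "i \<in> {1..n}" for i j
    using measurable_compose[OF x_measurable
      borel_measurable_continuous_onI[OF avg_cocoercive_continuous[OF n cocoercive L that]]] .
  have "(\<lambda>\<omega>. vfkm_U n G x k \<omega>) \<in> borel_measurable M" unfolding vfkm_U_def by measurable
  then show ?thesis .
qed

lemma St_measurable [measurable]: "St k \<in> borel_measurable M"
  and \<Delta>_measurable [measurable]: "\<Delta> k \<in> borel_measurable M"
  and \<Delta>_nonneg: "AE \<omega> in M. 0 \<le> \<Delta> k \<omega>"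
  using estimator by (auto simp: vr_unbiased_estimator_def)

lemma err_measurable [measurable]: "err k \<in> borel_measurable M"
  unfolding err_def[abs_def] vfkm_S_def by measurable

lemma x_0: "\<omega> \<in> space M \<Longrightarrow> x 0 \<omega> = x0"
  using iterates by (simp add: vfkm_iterates_def)

lemma err_0: "\<omega> \<in> space M \<Longrightarrow> err 0 \<omega> = 0"
  using iterates by (simp add: vfkm_iterates_def err_def)

lemma scaled_increment_Suc:
  assumes "\<omega> \<in> space M"
  shows "(real k + r + 2) *\<^sub>R incr (Suc k) \<omega> = drift k \<omega> - (2 * \<beta> * (real k + r)) *\<^sub>R err k \<omega>"
proof -
  have pos: "real k + r \<noteq> 0" "real k + r + 2 \<noteq> 0" using r by auto
  have coeff: "(real k + r + 2) * \<theta> k = real k" "(real k + r + 2) * \<eta> k = 2 * \<beta> * (real k + r)"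
    "2 * \<beta> * (real k + r) * \<gamma> k = 2 * \<beta> * real k"
    using pos by (simp_all add: \<theta> \<eta> \<gamma>)
  have "incr (Suc k) \<omega> = \<theta> k *\<^sub>R incr k \<omega> - \<eta> k *\<^sub>R (err k \<omega> + (A (x k \<omega>) - \<gamma> k *\<^sub>R A (x (k - 1) \<omega>)))"
    using iterates assms by (simp add: vfkm_iterates_def incr_def err_def vfkm_S_def)
  then have "(real k + r + 2) *\<^sub>R incr (Suc k) \<omega> = ((real k + r + 2) * \<theta> k) *\<^sub>R incr k \<omega>
      - ((real k + r + 2) * \<eta> k) *\<^sub>R (err k \<omega> + (A (x k \<omega>) - \<gamma> k *\<^sub>R A (x (k - 1) \<omega>)))"
    by (simp only: scaleR_diff_right scaleR_scaleR)
  also have "\<dots> = real k *\<^sub>R incr k \<omega> - (2 * \<beta> * (real k + r)) *\<^sub>R err k \<omega>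
      - ((2 * \<beta> * (real k + r)) *\<^sub>R A (x k \<omega>) - (2 * \<beta> * (real k + r) * \<gamma> k) *\<^sub>R A (x (k - 1) \<omega>))"
    unfolding coeff(1,2) by (simp add: scaleR_add_right scaleR_diff_right)
  finally show ?thesis
    unfolding coeff(3) by (simp add: drift_def scaleR_diff_right)
qed

lemma one_minus_gamma: "1 / (1 - \<gamma> k)\<^sup>2 = (real k + r)\<^sup>2 / r\<^sup>2"
proof -
  have "1 - \<gamma> k = r / (real k + r)" using r by (simp add: \<gamma> field_simps)
  then show ?thesis by (simp add: power_divide)
qed

lemma U_integrable:
  assumes "square_integrable M (x k)" "square_integrable M (x (k - 1))"
  shows "integrable M (vfkm_U n G x k)"
proof (rule Bochner_Integration.integrable_bound)
  show "integrable M (\<lambda>\<omega>. L\<^sup>2 * (norm (x k \<omega> - x (k - 1) \<omega>))\<^sup>2)"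
    using square_integrable_normD[OF square_integrable_diff[OF assms]] by simp
  show "AE \<omega> in M. norm (vfkm_U n G x k \<omega>) \<le> norm (L\<^sup>2 * (norm (x k \<omega> - x (k - 1) \<omega>))\<^sup>2)"
  proof (rule AE_I2)
    fix \<omega>
    show "norm (vfkm_U n G x k \<omega>) \<le> norm (L\<^sup>2 * (norm (x k \<omega> - x (k - 1) \<omega>))\<^sup>2)"
      unfolding vfkm_U_eq
      using mean_sq_dist_le[OF n cocoercive L, of "x k \<omega>" "x (k - 1) \<omega>"] mean_sq_dist_nonneg[of n G "x k \<omega>"]
      by simp
  qed
qed measurable

lemma square_integrable_A:
  assumes "square_integrable M (x k)"
  shows "square_integrable M (\<lambda>\<omega>. A (x k \<omega>))"
  using square_integrable_diff[OF assms square_integrable_const[of xs]]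
  by (rule square_integrable_bounded_by[where c = L]) (use norm_A_le in auto)

text \<open>
  The square integrability of the iterates up to time \<open>k\<close> is a hypothesis, because this lemma is itself the
  induction step that establishes it. Multiplying the variance condition by \<open>r\<^sup>2\<close> clears the factors
  \<open>1/(1-\<gamma>\<^sub>k)\<^sup>2 = (k+r)\<^sup>2/r\<^sup>2\<close>.
\<close>

lemma variance_recursion:
  assumes k: "k \<ge> 1" and x: "\<And>j. j \<le> k \<Longrightarrow> square_integrable M (x j)" and \<Delta>: "integrable M (\<Delta> (k - 1))"
  shows "integrable M (\<Delta> k)"
    and "(real k + r)\<^sup>2 * expectation (\<Delta> k) \<le> (1 - \<rho>) * (real k + r - 1)\<^sup>2 * expectation (\<Delta> (k - 1))
      + \<Theta> * (real k + r)\<^sup>2 * expectation (vfkm_U n G x k)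
      + \<Theta>h * (real k + r - 1)\<^sup>2 * expectation (vfkm_U n G x (k - 1))"
    and "square_integrable M (err k)" "expectation (\<lambda>\<omega>. (norm (err k \<omega>))\<^sup>2) \<le> expectation (\<Delta> k)"
proof -
  let ?p = "(1 - \<rho>) / (1 - \<gamma> (k - 1))\<^sup>2" and ?q = "\<Theta> / (1 - \<gamma> k)\<^sup>2" and ?s = "\<Theta>h / (1 - \<gamma> (k - 1))\<^sup>2"
  let ?h = "\<lambda>\<omega>. ?p * \<Delta> (k - 1) \<omega> + ?q * vfkm_U n G x k \<omega> + ?s * vfkm_U n G x (k - 1) \<omega>"
  have U: "integrable M (vfkm_U n G x k)" "integrable M (vfkm_U n G x (k - 1))"
    by (auto intro!: U_integrable x)
  have h: "integrable M ?h"
    using U \<Delta> by (intro Bochner_Integration.integrable_add integrable_mult_right) auto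
  have h0: "AE \<omega> in M. 0 \<le> ?h \<omega>"
    using \<Delta>_nonneg[of "k - 1"]
  proof eventually_elim
    case (elim \<omega>)
    have "0 \<le> vfkm_U n G x j \<omega>" for j by (simp add: vfkm_U_eq mean_sq_dist_nonneg)
    then show ?case
      using elim params by (intro add_nonneg_nonneg mult_nonneg_nonneg divide_nonneg_nonneg) auto
  qed
  have c: "0 < 1 / (1 - \<gamma> k)\<^sup>2" using r by (simp add: one_minus_gamma)
  have le: "AE \<omega> in M. ennreal (1 / (1 - \<gamma> k)\<^sup>2) * nn_cond_exp M (F k) (\<lambda>\<omega>. ennreal (\<Delta> k \<omega>)) \<omega> \<le> ennreal (?h \<omega>)"
    using estimator k by (simp add: vr_unbiased_estimator_def)
  note * = expectation_le_of_nn_cond_exp_le_real[OF subalgebra \<Delta>_measurable \<Delta>_nonneg h h0 c le]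
  show "integrable M (\<Delta> k)" by (rule *(1))
  have "expectation ?h = ?p * expectation (\<Delta> (k - 1)) + ?q * expectation (vfkm_U n G x k)
      + ?s * expectation (vfkm_U n G x (k - 1))"
    using U \<Delta> by simp
  with *(2) have 2: "1 / (1 - \<gamma> k)\<^sup>2 * expectation (\<Delta> k) \<le> ?p * expectation (\<Delta> (k - 1))
      + ?q * expectation (vfkm_U n G x k) + ?s * expectation (vfkm_U n G x (k - 1))"
    by simp
  have g: "c / (1 - \<gamma> j)\<^sup>2 = c * (real j + r)\<^sup>2 / r\<^sup>2" for c j
    using one_minus_gamma[of j] by (metis times_divide_eq_right mult.right_neutral)
  have k1: "real (k - 1) + r = real k + r - 1" using k by simp
  show "(real k + r)\<^sup>2 * expectation (\<Delta> k) \<le> (1 - \<rho>) * (real k + r - 1)\<^sup>2 * expectation (\<Delta> (k - 1))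
      + \<Theta> * (real k + r)\<^sup>2 * expectation (vfkm_U n G x k)
      + \<Theta>h * (real k + r - 1)\<^sup>2 * expectation (vfkm_U n G x (k - 1))"
    using mult_left_mono[OF 2, of "r\<^sup>2"] r unfolding g k1 by (simp add: distrib_left)
  have "integrable M (\<lambda>\<omega>. (norm (err k \<omega>))\<^sup>2) \<and> expectation (\<lambda>\<omega>. (norm (err k \<omega>))\<^sup>2) \<le> expectation (\<Delta> k)"
  proof (intro conjI expectation_le_of_nn_cond_exp_le[OF subalgebra[of k] _ _ *(1) \<Delta>_nonneg])
    show "AE \<omega> in M. nn_cond_exp M (F k) (\<lambda>\<omega>. ennreal ((norm (err k \<omega>))\<^sup>2)) \<omega>
        \<le> nn_cond_exp M (F k) (\<lambda>\<omega>. ennreal (\<Delta> k \<omega>)) \<omega>"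
      using estimator k by (simp add: vr_unbiased_estimator_def err_def)
    then show "AE \<omega> in M. nn_cond_exp M (F k) (\<lambda>\<omega>. ennreal ((norm (err k \<omega>))\<^sup>2)) \<omega>
        \<le> nn_cond_exp M (F k) (\<lambda>\<omega>. ennreal (\<Delta> k \<omega>)) \<omega>" .
  qed auto
  then show "square_integrable M (err k)" "expectation (\<lambda>\<omega>. (norm (err k \<omega>))\<^sup>2) \<le> expectation (\<Delta> k)"
    by (auto simp: square_integrable_def)
qed

text \<open>
  At \<open>k = 0\<close> the estimator is exact and \<open>\<Delta>\<^sub>0\<close> vanishes, so the induction starts without the variance
  condition, which is imposed from \<open>k = 1\<close> on.
\<close>

lemma second_moments: "(\<forall>j\<le>k. square_integrable M (x j)) \<and> integrable M (\<Delta> (k - 1))"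
proof (induction k)
  case 0
  have "square_integrable M (x 0)"
    by (rule square_integrable_bounded_by[OF square_integrable_const[of x0], where c = 1]) (auto simp: x_0)
  moreover have "integrable M (\<Delta> 0)"
    using \<Delta>0 by (subst integrable_cong_AE[where g = "\<lambda>_. 0"]) auto
  ultimately show ?case by simp
next
  case (Suc k)
  have x: "square_integrable M (x k)" "square_integrable M (x (k - 1))" using Suc by auto
  have \<Delta>: "integrable M (\<Delta> k)"
    using Suc variance_recursion(1)[of k] by (cases "k = 0") auto
  have "square_integrable M (err k)"
  proof (cases "k = 0")
    case True
    show ?thesis
      by (rule square_integrable_bounded_by[OF square_integrable_const[of 0], where c = 1]) (auto simp: True err_0)
  next
    case False
    then show ?thesis using Suc variance_recursion(3)[of k] by auto
  qed
  then have "square_integrable M (\<lambda>\<omega>. x k \<omega> + (1 / (real k + r + 2)) *\<^sub>R (drift k \<omega> - (2 * \<beta> * (real k + r)) *\<^sub>R err k \<omega>))"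
    unfolding drift_def incr_def
    by (intro square_integrable_add square_integrable_diff square_integrable_scaleR square_integrable_A x)
  moreover have "x (Suc k) \<omega> = x k \<omega> + (1 / (real k + r + 2)) *\<^sub>R (drift k \<omega> - (2 * \<beta> * (real k + r)) *\<^sub>R err k \<omega>)"
    if "\<omega> \<in> space M" for \<omega>
    unfolding scaled_increment_Suc[OF that, symmetric] using r by (simp add: incr_def)
  ultimately have "square_integrable M (x (Suc k))"
    by (elim square_integrable_bounded_by[where c = 1]) simp_all
  with Suc \<Delta> show ?case by (auto simp: le_Suc_eq)
qed

lemma x_sq [intro, simp]: "square_integrable M (x k)"
  using second_moments by blast

lemma \<Delta>_integrable: "integrable M (\<Delta> k)"
  using second_moments[of "Suc k"] by simp

lemmas variance_bounds = variance_recursion[OF _ x_sq \<Delta>_integrable]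

lemma A_sq [intro, simp]: "square_integrable M (\<lambda>\<omega>. A (x k \<omega>))"
  by (rule square_integrable_A) simp

lemma incr_sq [intro, simp]: "square_integrable M (incr k)"
  unfolding incr_def[abs_def] by (intro square_integrable_diff x_sq)

lemma X_sq [intro, simp]: "square_integrable M (\<lambda>\<omega>. x k \<omega> - xs)"
  by (intro square_integrable_diff x_sq square_integrable_const)

lemma drift_sq [intro, simp]: "square_integrable M (drift k)"
  unfolding drift_def[abs_def]
  by (intro square_integrable_diff square_integrable_scaleR A_sq incr_sq)

lemma resid_sq [intro, simp]: "square_integrable M (resid k)"
  unfolding resid_def[abs_def] by (intro square_integrable_add square_integrable_scaleR A_sq incr_sq)

lemma drift_measurable_F: "drift k \<in> borel_measurable (F k)"
proof -
  have [measurable]: "x k \<in> borel_measurable (F k)" "x (k - 1) \<in> borel_measurable (F k)"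
    by (auto intro: x_measurable_F)
  show ?thesis unfolding drift_def[abs_def] incr_def by measurable
qed

lemma gap_integrable: "integrable M (gap k)"
  unfolding gap_def[abs_def]
  by (intro Bochner_Integration.integrable_diff integrable_mult_right integrable_inner
      square_integrable_normD) auto

lemma energy_integrable: "integrable M (energy k)"
  unfolding energy_def[abs_def]
  by (intro Bochner_Integration.integrable_add integrable_mult_right gap_integrable
      square_integrable_normD square_integrable_add square_integrable_scaleR incr_sq X_sq)

text \<open>
  Unbiasedness enters here and nowhere else: the error is orthogonal to \<open>Z + y\<^sub>k\<close>, so it contributes its
  variance and nothing else. The three recursions below are instances with different \<open>Z\<close>.
\<close>

lemma expectation_shifted_increment:
  assumes k: "k \<ge> 1" and Z: "Z \<in> borel_measurable (F k)" "square_integrable M Z"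
  shows "expectation (\<lambda>\<omega>. (norm (Z \<omega> + (real k + r + 2) *\<^sub>R incr (Suc k) \<omega>))\<^sup>2)
    \<le> expectation (\<lambda>\<omega>. (norm (Z \<omega> + drift k \<omega>))\<^sup>2) + 4 * \<beta>\<^sup>2 * (real k + r)\<^sup>2 * expectation (\<Delta> k)"
proof -
  let ?c = "2 * \<beta> * (real k + r)"
  have centred: "AE \<omega> in M. vec_cond_exp M (F k) (err k) \<omega> = 0"
    using estimator k by (simp add: vr_unbiased_estimator_def err_def[abs_def])
  note Ym[measurable] = drift_measurable_F[of k] and Zm[measurable] = Z(1)
  have "expectation (\<lambda>\<omega>. (norm (Z \<omega> + (real k + r + 2) *\<^sub>R incr (Suc k) \<omega>))\<^sup>2)
      = expectation (\<lambda>\<omega>. (norm ((Z \<omega> + drift k \<omega>) - ?c *\<^sub>R err k \<omega>))\<^sup>2)"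
    by (intro Bochner_Integration.integral_cong refl) (simp add: scaled_increment_Suc add_diff_eq)
  also have "\<dots> = expectation (\<lambda>\<omega>. (norm (Z \<omega> + drift k \<omega>))\<^sup>2) + ?c\<^sup>2 * expectation (\<lambda>\<omega>. (norm (err k \<omega>))\<^sup>2)"
    by (intro expectation_norm_sq_cond_centred[OF subalgebra _ _ variance_bounds(3)[OF k] centred]
        square_integrable_add Z drift_sq) measurable
  also have "\<dots> \<le> expectation (\<lambda>\<omega>. (norm (Z \<omega> + drift k \<omega>))\<^sup>2) + ?c\<^sup>2 * expectation (\<Delta> k)"
    using variance_bounds(4)[OF k] by (intro add_left_mono mult_left_mono) auto
  finally show ?thesis by (simp add: power_mult_distrib)
qed

text \<open>
  The energy balance with the two cocoercivity estimates inserted: \<open>\<langle>G\<^sub>k - G\<^sub>k\<^sub>-\<^sub>1, d\<^sub>k\<rangle> \<ge> U\<^sub>k/L\<close> and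
  \<open>|G\<^sub>k - G\<^sub>k\<^sub>-\<^sub>1|\<^sup>2 \<le> U\<^sub>k\<close>. It also holds for \<open>k = 0\<close>, where it bounds the initial energy.
\<close>

lemma energy_after_step: "(norm (r *\<^sub>R (x k \<omega> - xs) + drift k \<omega>))\<^sup>2 + r * (norm (x k \<omega> - xs))\<^sup>2
    + 4 * \<beta> * r * (real k + 1) * gap k \<omega>
  \<le> energy k \<omega> - (2 * real k + r + 1) * (norm (incr k \<omega>))\<^sup>2
    - 4 * \<beta> * real k * (real k + r) * (1 / L - \<beta>) * vfkm_U n G x k \<omega>"
proof -
  let ?D = "A (x k \<omega>) - A (x (k - 1) \<omega>)"
  have X: "x k \<omega> - xs - incr k \<omega> = x (k - 1) \<omega> - xs" by (simp add: incr_def)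
  have "vfkm_U n G x k \<omega> \<le> L * (?D \<bullet> incr k \<omega>)"
    using avg_cocoerciveD[OF cocoercive L] by (simp add: vfkm_U_eq incr_def)
  then have "(1 / L) * vfkm_U n G x k \<omega> \<le> ?D \<bullet> incr k \<omega>" using L by (simp add: field_simps)
  moreover have "\<beta> * (norm ?D)\<^sup>2 \<le> \<beta> * vfkm_U n G x k \<omega>"
    using norm_avg_map_diff_le[OF n] \<beta> by (intro mult_left_mono) (auto simp: vfkm_U_eq)
  ultimately have "(1 / L - \<beta>) * vfkm_U n G x k \<omega> \<le> ?D \<bullet> incr k \<omega> - \<beta> * (norm ?D)\<^sup>2"
    by (simp add: algebra_simps)
  then have "4 * \<beta> * real k * (real k + r) * ((1 / L - \<beta>) * vfkm_U n G x k \<omega>)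
      \<le> 4 * \<beta> * real k * (real k + r) * (?D \<bullet> incr k \<omega> - \<beta> * (norm ?D)\<^sup>2)"
    using r \<beta> by (intro mult_left_mono) auto
  moreover have "0 \<le> 4 * \<beta> * r * (r - 1) * gap k \<omega>"
    using r \<beta> gap_nonneg by (intro mult_nonneg_nonneg) auto
  ultimately show ?thesis
    using energy_step_identity[of r "x k \<omega> - xs" "real k" "incr k \<omega>" \<beta> "A (x k \<omega>)" "A (x (k - 1) \<omega>)"]
    unfolding X drift_def energy_def gap_def by (simp only: mult.assoc)
qed

lemma energy_Suc: "energy (Suc k) \<omega> = (norm (r *\<^sub>R (x k \<omega> - xs) + (real k + r + 2) *\<^sub>R incr (Suc k) \<omega>))\<^sup>2
    + r * (norm (x k \<omega> - xs))\<^sup>2 + 4 * \<beta> * r * (real k + 1) * gap k \<omega>"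
  by (simp add: energy_def add_ac)

lemma expectation_energy_step:
  assumes k: "k \<ge> 1"
  shows "expectation (energy (Suc k)) \<le> expectation (energy k)
    - (2 * real k + r + 1) * expectation (\<lambda>\<omega>. (norm (incr k \<omega>))\<^sup>2)
    - 4 * \<beta> * real k * (real k + r) * (1 / L - \<beta>) * expectation (vfkm_U n G x k)
    + 4 * \<beta>\<^sup>2 * (real k + r)\<^sup>2 * expectation (\<Delta> k)"
proof -
  let ?Z = "\<lambda>\<omega>. r *\<^sub>R (x k \<omega> - xs)"
  let ?rest = "\<lambda>\<omega>. r * (norm (x k \<omega> - xs))\<^sup>2 + 4 * \<beta> * r * (real k + 1) * gap k \<omega>"
  have [measurable]: "x k \<in> borel_measurable (F k)" by (rule x_measurable_F) simp
  have Z: "?Z \<in> borel_measurable (F k)" "square_integrable M ?Z"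
    by (measurable, intro square_integrable_scaleR X_sq)
  have rest: "integrable M ?rest"
    by (intro Bochner_Integration.integrable_add integrable_mult_right gap_integrable square_integrable_normD X_sq)
  have int: "integrable M (\<lambda>\<omega>. (norm (?Z \<omega> + (real k + r + 2) *\<^sub>R incr (Suc k) \<omega>))\<^sup>2)"
    "integrable M (\<lambda>\<omega>. (norm (?Z \<omega> + drift k \<omega>))\<^sup>2)"
    by (intro square_integrable_normD square_integrable_add square_integrable_scaleR Z incr_sq drift_sq)+
  have intU: "integrable M (vfkm_U n G x k)" by (intro U_integrable x_sq)
  have intd: "integrable M (\<lambda>\<omega>. (norm (incr k \<omega>))\<^sup>2)" by (intro square_integrable_normD incr_sq)
  have "expectation (energy (Suc k))
      = expectation (\<lambda>\<omega>. (norm (?Z \<omega> + (real k + r + 2) *\<^sub>R incr (Suc k) \<omega>))\<^sup>2) + expectation ?rest"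
    unfolding energy_Suc[abs_def] using Bochner_Integration.integral_add[OF int(1) rest]
    by (simp only: add.assoc[of "(norm _)\<^sup>2"])
  also have "\<dots> \<le> expectation (\<lambda>\<omega>. (norm (?Z \<omega> + drift k \<omega>))\<^sup>2) + expectation ?rest
      + 4 * \<beta>\<^sup>2 * (real k + r)\<^sup>2 * expectation (\<Delta> k)"
    using expectation_shifted_increment[OF k Z] by simp
  also have "expectation (\<lambda>\<omega>. (norm (?Z \<omega> + drift k \<omega>))\<^sup>2) + expectation ?rest
      = expectation (\<lambda>\<omega>. (norm (?Z \<omega> + drift k \<omega>))\<^sup>2 + ?rest \<omega>)"
    using int(2) rest by (rule Bochner_Integration.integral_add[symmetric])
  also have "\<dots> \<le> expectation (\<lambda>\<omega>. energy k \<omega> - (2 * real k + r + 1) * (norm (incr k \<omega>))\<^sup>2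
      - 4 * \<beta> * real k * (real k + r) * (1 / L - \<beta>) * vfkm_U n G x k \<omega>)"
  proof (rule integral_mono[OF Bochner_Integration.integrable_add[OF int(2) rest]])
    show "integrable M (\<lambda>\<omega>. energy k \<omega> - (2 * real k + r + 1) * (norm (incr k \<omega>))\<^sup>2
        - 4 * \<beta> * real k * (real k + r) * (1 / L - \<beta>) * vfkm_U n G x k \<omega>)"
      using energy_integrable intU intd
      by (intro Bochner_Integration.integrable_diff integrable_mult_right) auto
  qed (use energy_after_step in \<open>simp only: add.assoc\<close>)
  also have "\<dots> = expectation (energy k) - (2 * real k + r + 1) * expectation (\<lambda>\<omega>. (norm (incr k \<omega>))\<^sup>2)
      - 4 * \<beta> * real k * (real k + r) * (1 / L - \<beta>) * expectation (vfkm_U n G x k)"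
    using energy_integrable intU intd by simp
  finally show ?thesis by simp
qed

lemma resid_Suc: "resid (Suc k) \<omega> = incr (Suc k) \<omega> + (2 * \<beta> * (real k + r) / (real k + r + 2)) *\<^sub>R A (x k \<omega>)"
  by (simp add: resid_def add_ac)

lemma expectation_residual_step:
  assumes k: "k \<ge> 1"
  shows "(real k + r + 2)\<^sup>2 * expectation (\<lambda>\<omega>. (norm (resid (Suc k) \<omega>))\<^sup>2)
    \<le> ((real k + r + 1)\<^sup>2 - (r - 2) * (real k + r + 1)) * expectation (\<lambda>\<omega>. (norm (resid k \<omega>))\<^sup>2)
      + (4 / r) * (real k + 3) * expectation (\<lambda>\<omega>. (norm (incr k \<omega>))\<^sup>2)
      + 4 * \<beta>\<^sup>2 * (real k + r)\<^sup>2 * expectation (\<Delta> k)"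
proof -
  let ?Z = "\<lambda>\<omega>. (2 * \<beta> * (real k + r)) *\<^sub>R A (x k \<omega>)"
  have [measurable]: "x k \<in> borel_measurable (F k)" by (rule x_measurable_F) simp
  have Z: "?Z \<in> borel_measurable (F k)" "square_integrable M ?Z"
    by (measurable, intro square_integrable_scaleR A_sq)
  have pos: "real k + r + 2 \<noteq> 0" using r by simp
  have int: "integrable M (\<lambda>\<omega>. (norm (?Z \<omega> + drift k \<omega>))\<^sup>2)"
    by (intro square_integrable_normD square_integrable_add Z drift_sq)
  have intd: "integrable M (\<lambda>\<omega>. (norm (incr k \<omega>))\<^sup>2)" "integrable M (\<lambda>\<omega>. (norm (resid k \<omega>))\<^sup>2)"
    by (intro square_integrable_normD incr_sq resid_sq)+
  have "(real k + r + 2) *\<^sub>R resid (Suc k) \<omega> = ?Z \<omega> + (real k + r + 2) *\<^sub>R incr (Suc k) \<omega>" for \<omega>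
    using pos by (simp add: resid_Suc scaleR_add_right)
  then have "(real k + r + 2)\<^sup>2 * (norm (resid (Suc k) \<omega>))\<^sup>2 = (norm (?Z \<omega> + (real k + r + 2) *\<^sub>R incr (Suc k) \<omega>))\<^sup>2" for \<omega>
    using norm_sq_scaleR[of "real k + r + 2" "resid (Suc k) \<omega>"] by simp
  then have "(real k + r + 2)\<^sup>2 * expectation (\<lambda>\<omega>. (norm (resid (Suc k) \<omega>))\<^sup>2)
      = expectation (\<lambda>\<omega>. (norm (?Z \<omega> + (real k + r + 2) *\<^sub>R incr (Suc k) \<omega>))\<^sup>2)"
    by (simp flip: integral_mult_right_zero)
  also have "\<dots> \<le> expectation (\<lambda>\<omega>. (norm (?Z \<omega> + drift k \<omega>))\<^sup>2) + 4 * \<beta>\<^sup>2 * (real k + r)\<^sup>2 * expectation (\<Delta> k)"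
    by (rule expectation_shifted_increment[OF k Z])
  also have "expectation (\<lambda>\<omega>. (norm (?Z \<omega> + drift k \<omega>))\<^sup>2)
      \<le> expectation (\<lambda>\<omega>. ((real k + r + 1)\<^sup>2 - (r - 2) * (real k + r + 1)) * (norm (resid k \<omega>))\<^sup>2
        + (4 / r) * (real k + 3) * (norm (incr k \<omega>))\<^sup>2)"
  proof (intro integral_mono int Bochner_Integration.integrable_add integrable_mult_right intd)
    fix \<omega>
    have "?Z \<omega> + drift k \<omega> = real k *\<^sub>R (incr k \<omega> + (2 * \<beta>) *\<^sub>R A (x (k - 1) \<omega>))"
      by (simp add: drift_def scaleR_add_right scaleR_diff_right mult_ac)
    then show "(norm (?Z \<omega> + drift k \<omega>))\<^sup>2 \<le> ((real k + r + 1)\<^sup>2 - (r - 2) * (real k + r + 1)) * (norm (resid k \<omega>))\<^sup>2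
        + (4 / r) * (real k + 3) * (norm (incr k \<omega>))\<^sup>2"
      using residual_step_bound[of "real k" r "incr k \<omega>" \<beta> "A (x (k - 1) \<omega>)"] k r by (simp add: resid_def)
  qed
  also have "\<dots> = ((real k + r + 1)\<^sup>2 - (r - 2) * (real k + r + 1)) * expectation (\<lambda>\<omega>. (norm (resid k \<omega>))\<^sup>2)
      + (4 / r) * (real k + 3) * expectation (\<lambda>\<omega>. (norm (incr k \<omega>))\<^sup>2)"
    using intd by simp
  finally show ?thesis by simp
qed

lemma expectation_increment_step:
  assumes k: "k \<ge> 1"
  shows "(real k + r + 2)\<^sup>2 * expectation (\<lambda>\<omega>. (norm (incr (Suc k) \<omega>))\<^sup>2)
    \<le> (real k + r + 1)\<^sup>2 * expectation (\<lambda>\<omega>. (norm (incr k \<omega>))\<^sup>2)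
      + 2 * \<beta>\<^sup>2 * r * (3 * real k + 2 * r) * expectation (\<lambda>\<omega>. (norm (A (x k \<omega>)))\<^sup>2)
      + 4 * \<beta>\<^sup>2 * (real k + r)\<^sup>2 * expectation (\<Delta> k)"
proof -
  have int: "integrable M (\<lambda>\<omega>. (norm (incr k \<omega>))\<^sup>2)" "integrable M (\<lambda>\<omega>. (norm (A (x k \<omega>)))\<^sup>2)"
    "integrable M (\<lambda>\<omega>. (norm (drift k \<omega>))\<^sup>2)"
    by (intro square_integrable_normD incr_sq A_sq drift_sq)+
  have "(real k + r + 2)\<^sup>2 * expectation (\<lambda>\<omega>. (norm (incr (Suc k) \<omega>))\<^sup>2)
      = expectation (\<lambda>\<omega>. (norm (0 + (real k + r + 2) *\<^sub>R incr (Suc k) \<omega>))\<^sup>2)"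
    by (simp add: power_mult_distrib)
  also have "\<dots> \<le> expectation (\<lambda>\<omega>. (norm (0 + drift k \<omega>))\<^sup>2) + 4 * \<beta>\<^sup>2 * (real k + r)\<^sup>2 * expectation (\<Delta> k)"
    using k by (intro expectation_shifted_increment square_integrable_const) auto
  also have "expectation (\<lambda>\<omega>. (norm (0 + drift k \<omega>))\<^sup>2) \<le> expectation (\<lambda>\<omega>. (real k + r + 1)\<^sup>2 * (norm (incr k \<omega>))\<^sup>2
      + 2 * \<beta>\<^sup>2 * r * (3 * real k + 2 * r) * (norm (A (x k \<omega>)))\<^sup>2)"
  proof (unfold add_0, intro integral_mono int Bochner_Integration.integrable_add integrable_mult_right)
    fix \<omega>
    have "(norm (A (x k \<omega>) - A (x (k - 1) \<omega>)))\<^sup>2 \<le> L * ((A (x k \<omega>) - A (x (k - 1) \<omega>)) \<bullet> incr k \<omega>)"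
      unfolding incr_def by (rule order_trans[OF norm_avg_map_diff_le[OF n] avg_cocoerciveD[OF cocoercive L]])
    then show "(norm (drift k \<omega>))\<^sup>2 \<le> (real k + r + 1)\<^sup>2 * (norm (incr k \<omega>))\<^sup>2
      + 2 * \<beta>\<^sup>2 * r * (3 * real k + 2 * r) * (norm (A (x k \<omega>)))\<^sup>2"
      unfolding drift_def using k r L \<beta>(1) beta_le(1) by (intro increment_step_bound) auto
  qed
  also have "\<dots> = (real k + r + 1)\<^sup>2 * expectation (\<lambda>\<omega>. (norm (incr k \<omega>))\<^sup>2)
      + 2 * \<beta>\<^sup>2 * r * (3 * real k + 2 * r) * expectation (\<lambda>\<omega>. (norm (A (x k \<omega>)))\<^sup>2)"
    using int by simp
  finally show ?thesis by simp
qed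

lemma expectation_operator_le:
  "(2 * \<beta> * (real k + r) / (real k + r + 2))\<^sup>2 * expectation (\<lambda>\<omega>. (norm (A (x k \<omega>)))\<^sup>2)
    \<le> 2 * expectation (\<lambda>\<omega>. (norm (incr (Suc k) \<omega>))\<^sup>2) + 2 * expectation (\<lambda>\<omega>. (norm (resid (Suc k) \<omega>))\<^sup>2)"
proof -
  let ?c = "2 * \<beta> * (real k + r) / (real k + r + 2)"
  have int: "integrable M (\<lambda>\<omega>. (norm (incr (Suc k) \<omega>))\<^sup>2)" "integrable M (\<lambda>\<omega>. (norm (A (x k \<omega>)))\<^sup>2)"
    "integrable M (\<lambda>\<omega>. (norm (resid (Suc k) \<omega>))\<^sup>2)"
    by (intro square_integrable_normD incr_sq A_sq resid_sq)+
  have "?c\<^sup>2 * expectation (\<lambda>\<omega>. (norm (A (x k \<omega>)))\<^sup>2) = expectation (\<lambda>\<omega>. ?c\<^sup>2 * (norm (A (x k \<omega>)))\<^sup>2)"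
    by simp
  also have "\<dots> \<le> expectation (\<lambda>\<omega>. 2 * (norm (incr (Suc k) \<omega>))\<^sup>2 + 2 * (norm (resid (Suc k) \<omega>))\<^sup>2)"
  proof (intro integral_mono int Bochner_Integration.integrable_add integrable_mult_right)
    fix \<omega>
    have "?c\<^sup>2 * (norm (A (x k \<omega>)))\<^sup>2 = (norm (resid (Suc k) \<omega> - incr (Suc k) \<omega>))\<^sup>2"
      unfolding resid_Suc norm_sq_scaleR[symmetric] by simp
    also have "\<dots> \<le> 2 * (norm (incr (Suc k) \<omega>))\<^sup>2 + 2 * (norm (resid (Suc k) \<omega>))\<^sup>2"
      using zero_le_power2[of "norm (resid (Suc k) \<omega> + incr (Suc k) \<omega>)"]
      by (simp add: power2_norm_eq_inner inner_add_left inner_add_right inner_diff_left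
          inner_diff_right inner_commute)
    finally show "?c\<^sup>2 * (norm (A (x k \<omega>)))\<^sup>2 \<le> 2 * (norm (incr (Suc k) \<omega>))\<^sup>2 + 2 * (norm (resid (Suc k) \<omega>))\<^sup>2" .
  qed
  also have "\<dots> = 2 * expectation (\<lambda>\<omega>. (norm (incr (Suc k) \<omega>))\<^sup>2) + 2 * expectation (\<lambda>\<omega>. (norm (resid (Suc k) \<omega>))\<^sup>2)"
    using int by simp
  finally show ?thesis .
qed

lemma first_step:
  assumes "\<omega> \<in> space M"
  shows "(r + 2) *\<^sub>R incr 1 \<omega> = - ((2 * \<beta> * r) *\<^sub>R A x0)"
  using scaled_increment_Suc[OF assms, of 0] assms by (simp add: drift_def err_0 x_0)

text \<open>
  The first step is noise free, so the pathwise balance applies to it directly, starting from energy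
  \<open>r\<^sup>2|X\<^sub>0|\<^sup>2 + r|X\<^sub>0|\<^sup>2\<close>.
\<close>

lemma energy_1_le:
  assumes "\<omega> \<in> space M"
  shows "energy 1 \<omega> \<le> r * (r + 1) * (norm (x0 - xs))\<^sup>2"
proof -
  have "energy 1 \<omega> = (norm (r *\<^sub>R (x 0 \<omega> - xs) + drift 0 \<omega>))\<^sup>2 + r * (norm (x 0 \<omega> - xs))\<^sup>2
      + 4 * \<beta> * r * (real 0 + 1) * gap 0 \<omega>"
    using energy_Suc[of 0 \<omega>] scaled_increment_Suc[OF assms, of 0] by (simp add: err_0[OF assms])
  also have "\<dots> \<le> energy 0 \<omega> - (2 * real 0 + r + 1) * (norm (incr 0 \<omega>))\<^sup>2
    - 4 * \<beta> * real 0 * (real 0 + r) * (1 / L - \<beta>) * vfkm_U n G x 0 \<omega>"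
    by (rule energy_after_step)
  also have "\<dots> = r * (r + 1) * (norm (x0 - xs))\<^sup>2"
    by (simp add: energy_def incr_def x_0[OF assms] power_mult_distrib) (simp add: power2_eq_square algebra_simps)
  finally show ?thesis .
qed

lemma first_increment_le:
  assumes "\<omega> \<in> space M"
  shows "(r + 2)\<^sup>2 * (norm (incr 1 \<omega>))\<^sup>2 \<le> 4 * \<beta>\<^sup>2 * r\<^sup>2 * L\<^sup>2 * (norm (x0 - xs))\<^sup>2"
proof -
  have "(r + 2)\<^sup>2 * (norm (incr 1 \<omega>))\<^sup>2 = (2 * \<beta> * r)\<^sup>2 * (norm (A x0))\<^sup>2"
    using arg_cong[OF first_step[OF assms], of "\<lambda>z. (norm z)\<^sup>2"] by (simp add: power_mult_distrib)
  also have "\<dots> \<le> (2 * \<beta> * r)\<^sup>2 * (L * norm (x0 - xs))\<^sup>2"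
    by (intro mult_left_mono power_mono norm_A_le) auto
  finally show ?thesis by (simp add: power_mult_distrib)
qed

lemma first_residual: "\<omega> \<in> space M \<Longrightarrow> resid 1 \<omega> = 0"
proof -
  assume w: "\<omega> \<in> space M"
  have "(r + 2) *\<^sub>R resid 1 \<omega> = 0"
    using first_step[OF w] resid_Suc[of 0 \<omega>] r by (simp add: scaleR_add_right x_0[OF w])
  then show ?thesis using r by simp
qed

sublocale moments: vfkm_moments r L \<beta> \<rho> \<Theta> \<Theta>h "(norm (x0 - xs))\<^sup>2"
  "\<lambda>k. expectation (energy k)" "\<lambda>k. expectation (\<lambda>\<omega>. (norm (incr k \<omega>))\<^sup>2)"
  "\<lambda>k. expectation (\<lambda>\<omega>. (norm (resid k \<omega>))\<^sup>2)" "\<lambda>k. expectation (\<lambda>\<omega>. (norm (A (x k \<omega>)))\<^sup>2)"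
  "\<lambda>k. expectation (vfkm_U n G x k)" "\<lambda>k. expectation (\<Delta> k)"
proof
  show "r > 2" "L > 0" "0 < \<beta>" "\<beta> < beta_bar r L \<rho> \<Theta> \<Theta>h" by (fact r L \<beta>)+
  show "0 < \<rho>" "\<rho> < 1" "0 < \<Theta>" "0 \<le> \<Theta>h" by (fact params)+
  fix k
  show "0 \<le> expectation (energy k)" using energy_nonneg by (intro Bochner_Integration.integral_nonneg)
  show "0 \<le> expectation (vfkm_U n G x k)"
    using mean_sq_dist_nonneg by (intro Bochner_Integration.integral_nonneg) (simp add: vfkm_U_eq)
  show "0 \<le> expectation (\<Delta> k)" by (rule integral_nonneg_AE[OF \<Delta>_nonneg])
  show "expectation (energy 1) \<le> r * (r + 1) * (norm (x0 - xs))\<^sup>2"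
    using energy_1_le by (intro integral_le_const energy_integrable AE_I2)
  have "expectation (\<lambda>\<omega>. (r + 2)\<^sup>2 * (norm (incr 1 \<omega>))\<^sup>2) \<le> 4 * \<beta>\<^sup>2 * r\<^sup>2 * L\<^sup>2 * (norm (x0 - xs))\<^sup>2"
    using first_increment_le
    by (intro integral_le_const integrable_mult_right square_integrable_normD incr_sq AE_I2)
  then show "(r + 2)\<^sup>2 * expectation (\<lambda>\<omega>. (norm (incr 1 \<omega>))\<^sup>2) \<le> 4 * \<beta>\<^sup>2 * r\<^sup>2 * L\<^sup>2 * (norm (x0 - xs))\<^sup>2"
    by simp
  show "expectation (\<lambda>\<omega>. (norm (resid 1 \<omega>))\<^sup>2) = 0"
    using first_residual by (intro integral_eq_zero_AE AE_I2) simp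
  show "expectation (vfkm_U n G x 0) = 0"
    by (intro integral_eq_zero_AE AE_I2) (simp add: vfkm_U_def)
  show "expectation (\<Delta> 0) = 0" by (rule integral_eq_zero_AE[OF \<Delta>0])
qed (use expectation_energy_step variance_bounds(2) expectation_residual_step expectation_increment_step
  expectation_operator_le in auto)

end

section \<open>Convergence rates\<close>

theorem theorem1:
  fixes M :: "'w measure"
    and F :: "nat \<Rightarrow> 'w measure"
    and n :: nat
    and G :: "nat \<Rightarrow> real^'p \<Rightarrow> real^'p"
    and L r \<beta> \<rho> \<Theta> \<Theta>h :: real
    and \<theta> \<gamma> \<eta> :: "nat \<Rightarrow> real"
    and x0 xs :: "real^'p"
    and x St :: "nat \<Rightarrow> 'w \<Rightarrow> real^'p"
    and \<Delta> :: "nat \<Rightarrow> 'w \<Rightarrow> real"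
  assumes prob: "prob_space M"
    and n: "n \<ge> 1"
    and zer_nonempty: "zer (avg_map n G) \<noteq> {}"
    and L: "L > 0"
    and cocoercive: "avg_cocoercive n G L"
    and r: "r > 2"
    and \<beta>: "0 < \<beta>" "\<beta> < beta_bar r L \<rho> \<Theta> \<Theta>h"
    and \<theta>: "\<And>k. \<theta> k = real k / (real k + r + 2)"
    and \<gamma>: "\<And>k. \<gamma> k = real k / (real k + r)"
    and \<eta>: "\<And>k. \<eta> k = 2 * \<beta> * (real k + r) / (real k + r + 2)"
    and iterates: "vfkm_iterates M n G \<theta> \<gamma> \<eta> x0 x St"
    and filtr: "vfkm_filtration M F x \<Delta>"
    and estimator: "vr_unbiased_estimator M F n G \<gamma> x St \<rho> \<Theta> \<Theta>h \<Delta>"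
    and \<Delta>0: "AE \<omega> in M. \<Delta> 0 \<omega> = 0"
    and xs: "xs \<in> zer (avg_map n G)"
  defines "ED \<equiv> \<lambda>k. prob_space.expectation M (\<lambda>\<omega>. (norm (x (Suc k) \<omega> - x k \<omega>))\<^sup>2)"
    and "EG \<equiv> \<lambda>k. prob_space.expectation M (\<lambda>\<omega>. (norm (avg_map n G (x k \<omega>)))\<^sup>2)"
  shows
    \<comment> \<open>the expectations exist\<close>
    "(\<forall>k. integrable M (\<lambda>\<omega>. (norm (x (Suc k) \<omega> - x k \<omega>))\<^sup>2)
        \<and> integrable M (\<lambda>\<omega>. (norm (avg_map n G (x k \<omega>)))\<^sup>2))
     \<and>
     \<comment> \<open>(a)\<close>
     (summable (\<lambda>k. (2 * real k + r + 3) * ED k)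
        \<and> (\<Sum>k. (2 * real k + r + 3) * ED k) \<le> const_C0 r L \<beta> * (norm (x0 - xs))\<^sup>2)
     \<and> (summable (\<lambda>k. (2 * real k + r + 3) * EG k)
        \<and> (\<Sum>k. (2 * real k + r + 3) * EG k)
            \<le> (r + 2)\<^sup>2 / (2 * \<beta>\<^sup>2 * r\<^sup>2)
                * (const_C0 r L \<beta> + 2 * const_C1 r L \<beta> \<rho> \<Theta> \<Theta>h / (r - 2))
                * (norm (x0 - xs))\<^sup>2)
     \<and>
     \<comment> \<open>(b)\<close>
     (\<forall>k. ED k \<le> const_C2 r L \<beta> \<rho> \<Theta> \<Theta>h * (norm (x0 - xs))\<^sup>2 / (real k + r + 2)\<^sup>2)
     \<and> (\<forall>k. EG k \<le> const_C3 r L \<beta> \<rho> \<Theta> \<Theta>h * (norm (x0 - xs))\<^sup>2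
                      / (\<beta>\<^sup>2 * (real k + r - 1) * (real k + r + 2)))
     \<and>
     \<comment> \<open>(c)\<close>
     (\<lambda>k. (real k)\<^sup>2 * ED k) \<longlonglongrightarrow> 0
     \<and> (\<lambda>k. (real k)\<^sup>2 * EG k) \<longlonglongrightarrow> 0
     \<and>
     \<comment> \<open>iteration complexity \<open>\<O>(1/\<epsilon>)\<close>\<close>
     (\<exists>C>0. \<forall>\<epsilon>>0. \<exists>K::nat. real K \<le> C / \<epsilon> \<and> (\<forall>k\<ge>K. EG k \<le> \<epsilon>\<^sup>2))"
proof -
  interpret vfkm_run M F n G L r \<beta> \<rho> \<Theta> \<Theta>h \<theta> \<gamma> \<eta> x0 xs x St \<Delta>
    using assms unfolding vfkm_run_def vfkm_run_axioms_def by blast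
  have ED: "ED = (\<lambda>k. expectation (\<lambda>\<omega>. (norm (incr (Suc k) \<omega>))\<^sup>2))"
    by (simp add: ED_def incr_def)
  have "integrable M (\<lambda>\<omega>. (norm (x (Suc k) \<omega> - x k \<omega>))\<^sup>2) \<and> integrable M (\<lambda>\<omega>. (norm (A (x k \<omega>)))\<^sup>2)" for k
    by (intro conjI square_integrable_normD square_integrable_diff x_sq A_sq)
  moreover have "(\<Sum>k<K. (2 * real k + r + 3) * ED k) \<le> const_C0 r L \<beta> * (norm (x0 - xs))\<^sup>2" for K
    unfolding ED using moments.increment_sum_Suc moments.energy_le by (rule order_trans)
  then have "(\<Sum>k. (2 * real k + r + 3) * ED k) \<le> const_C0 r L \<beta> * (norm (x0 - xs))\<^sup>2"
    unfolding ED by (rule suminf_le_const[OF moments.increment_summable])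
  moreover have "(\<Sum>k. (2 * real k + r + 3) * EG k) \<le> (r + 2)\<^sup>2 / (2 * \<beta>\<^sup>2 * r\<^sup>2)
      * (const_C0 r L \<beta> + 2 * const_C1 r L \<beta> \<rho> \<Theta> \<Theta>h / (r - 2)) * (norm (x0 - xs))\<^sup>2"
    unfolding EG_def by (rule suminf_le_const[OF moments.operator_summable moments.operator_sum])
  moreover have "ED k \<le> const_C2 r L \<beta> \<rho> \<Theta> \<Theta>h * (norm (x0 - xs))\<^sup>2 / (real k + r + 2)\<^sup>2" for k
  proof -
    have "0 < (real k + r + 2)\<^sup>2" using r by simp
    then show ?thesis
      using moments.increment_le[of k] unfolding ED by (simp add: pos_le_divide_eq mult.commute)
  qed
  ultimately show ?thesis
    using moments.increment_summable moments.operator_summable moments.operator_rate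
      moments.increment_tendsto_0 moments.operator_tendsto_0 moments.operator_complexity
    unfolding ED EG_def by blast
qed

end
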